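(* Let $(\mathfrak{E},h)=(E,\Phi,h)$ be a hermitian Higgs bundle over a compact Kähler manifold $M$, $D_h$ the Chern connection of $(E,h)$ and $S\subset E$ a holomorphic subbundle, with orthogonal complement $S^{\perp}$ with respect to $h$. If the second fundamental form $A_h$ of $S$ in $(E,h)$ vanishes identically and $S$ is $\Phi$-invariant and $\bar\Phi_h$-invariant, then $\mathfrak{S}=(S,\Phi|_S)$ and $\mathfrak{S}^{\perp}=(S^{\perp},\Phi|_{S^{\perp}})$ are Higgs subbundles of $\mathfrak{E}=(E,\Phi)$ and $$\mathfrak{E}=\mathfrak{S}\oplus\mathfrak{S}^{\perp}$$ is a Higgs orthogonal decomposition.
   Context: $M$ is a compact Kähler manifold with holomorphic cotangent bundle $\Omega^{1,0}$ and complex conjugate bundle $\Omega^{0,1}$. For a $C^\infty$ complex vector bundle $V$ over $M$, $A^s(V)$ (resp. $A^{p,q}(V)$) is the space of $C^\infty$ complex $s$-forms (resp. $(p,q)$-forms) on $M$ with values in $V$. A Higgs bundle $\mathfrak{E}=(E,\Phi)$ over $M$ is a holomorphic vector bundle $E$ with a holomorphic $\Phi\in A^{1,0}(\mathrm{End}\,E)$ (the Higgs field) satisfying $\Phi\wedge\Phi=0$. A hermitian Higgs bundle $(\mathfrak{E},h)=(E,\Phi,h)$ is a Higgs bundle with a hermitian metric $h$ in $E$. $\bar\Phi_h\in A^{0,1}(\mathrm{End}\,E)$ is the hermitian conjugate of $\Phi$ with respect to $h$, i.e. $h(\bar\Phi_h\xi,\eta)=h(\xi,\Phi\eta)$ for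 all sections $\xi,\eta$ of $E$. For a holomorphic subbundle $S\subset E$, the second fundamental form $A_h\in A^{1,0}(\mathrm{Hom}(S,S^{\perp}))$ of $S$ in $(E,h)$ is defined by $D_h\xi=D_{h,S}\xi+A_h\xi$ for $\xi\in A^0(S)$, with $D_{h,S}\xi\in A^1(S)$ and $A_h\xi\in A^1(S^{\perp})$. A subbundle $F\subset E$ is $\Phi$-invariant (resp. $\bar\Phi_h$-invariant) if $\Phi(F)\subset F\otimes\Omega^{1,0}$ (resp. $\bar\Phi_h(F)\subset F\otimes\Omega^{0,1}$). A Higgs subbundle of $\mathfrak{E}$ is a $\Phi$-invariant holomorphic subbundle $F\subset E$, regarded as the Higgs bundle $(F,\Phi|_F)$. A Higgs orthogonal decomposition $\mathfrak{E}=\mathfrak{S}\oplus\mathfrak{S}^{\perp}$ is a holomorphic direct sum decomposition $E=S\oplus S^{\perp}$, orthogonal with respect to $h$, in which both summands are Higgs subbundles of $\mathfrak{E}$. *)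

theory Defs
  imports "HOL-Analysis.Analysis"
begin

section \<open>Smooth and holomorphic functions on open subsets of vector spaces\<close>

text \<open>Both notions are meant for open \<open>U\<close>, so that Frechet derivatives are unique. A holomorphic
  function of several variables is a \<open>C\<^sup>\<infinity>\<close> function with \<open>\<partial>\<close>-bar \<open>f = 0\<close>, that is, with
  complex-linear differential.\<close>

primrec Ck_on :: "nat \<Rightarrow> 'a::real_normed_vector set \<Rightarrow> ('a \<Rightarrow> 'b::real_normed_vector) \<Rightarrow> bool" where
  "Ck_on 0 U f \<longleftrightarrow> continuous_on U f"
| "Ck_on (Suc k) U f \<longleftrightarrow> (\<forall>x\<in>U. f differentiable (at x)) \<and>
     (\<forall>v. Ck_on k U (\<lambda>x. frechet_derivative f (at x) v))"

definition Cinf_on :: "'a::real_normed_vector set \<Rightarrow> ('a \<Rightarrow> 'b::real_normed_vector) \<Rightarrow> bool" where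
  "Cinf_on U f \<longleftrightarrow> (\<forall>k. Ck_on k U f)"

definition hol_on :: "(complex^'n::finite) set \<Rightarrow> (complex^'n \<Rightarrow> complex) \<Rightarrow> bool" where
  "hol_on U f \<longleftrightarrow> Cinf_on U f \<and>
     (\<forall>z\<in>U. \<forall>v. frechet_derivative f (at z) (\<i> *s v) = \<i> * frechet_derivative f (at z) v)"


section \<open>Complex manifolds\<close>

text \<open>The manifold is the whole type \<open>'m\<close>; a chart is a pair of its domain and its coordinate map.\<close>

type_synonym ('m, 'n) chart = "'m set \<times> ('m \<Rightarrow> complex^'n)"

abbreviation chart_inv :: "('m, 'n) chart \<Rightarrow> complex^'n \<Rightarrow> 'm" where
  "chart_inv c \<equiv> inv_into (fst c) (snd c)"

definition complex_manifold ::
    "('m::{t2_space,second_countable_topology}, 'n::finite) chart set \<Rightarrow> bool" where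
  "complex_manifold M \<longleftrightarrow>
     (\<Union>c\<in>M. fst c) = UNIV \<and>
     (\<forall>c\<in>M. open (fst c) \<and> open (snd c ` fst c) \<and>
        homeomorphism (fst c) (snd c ` fst c) (snd c) (chart_inv c)) \<and>
     (\<forall>c\<in>M. \<forall>c'\<in>M. \<forall>k. hol_on (snd c ` (fst c \<inter> fst c')) (\<lambda>z. snd c' (chart_inv c z) $ k))"

definition smooth_fun ::
    "('m, 'n::finite) chart set \<Rightarrow> 'm set \<Rightarrow> ('m \<Rightarrow> 'b::real_normed_vector) \<Rightarrow> bool" where
  "smooth_fun M U f \<longleftrightarrow> (\<forall>c\<in>M. Cinf_on (snd c ` (U \<inter> fst c)) (f \<circ> chart_inv c))"

definition hol_fun ::
    "('m, 'n::finite) chart set \<Rightarrow> 'm set \<Rightarrow> ('m \<Rightarrow> complex) \<Rightarrow> bool" where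
  "hol_fun M U f \<longleftrightarrow> (\<forall>c\<in>M. hol_on (snd c ` (U \<inter> fst c)) (f \<circ> chart_inv c))"


section \<open>Tangent vectors\<close>

text \<open>A (real) tangent vector at \<open>x\<close> is the family of its coordinate vectors in all charts around
  \<open>x\<close>, related by the differentials of the coordinate changes. Charts that do not contain \<open>x\<close> get
  the coordinate vector \<open>0\<close>. The operations of the tangent space, including the complex structure,
  are componentwise.\<close>

type_synonym ('m, 'n) tvec = "('m, 'n) chart \<Rightarrow> complex^'n"

definition tangent_space :: "('m, 'n::finite) chart set \<Rightarrow> 'm \<Rightarrow> ('m, 'n) tvec set" where
  "tangent_space M x = {X.
     (\<forall>c\<in>M. \<forall>c'\<in>M. x \<in> fst c \<longrightarrow> x \<in> fst c' \<longrightarrow>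
        X c' = frechet_derivative (snd c' \<circ> chart_inv c) (at (snd c x)) (X c)) \<and>
     (\<forall>c. \<not> (c \<in> M \<and> x \<in> fst c) \<longrightarrow> X c = 0)}"

abbreviation tangent_J :: "('m, 'n::finite) tvec \<Rightarrow> ('m, 'n) tvec" where
  "tangent_J X \<equiv> (\<lambda>c. \<i> *s X c)"

text \<open>The tangent vector at \<open>x\<close> with coordinates \<open>u\<close> in the chart \<open>c\<close>; for fixed \<open>u\<close> this is a
  coordinate vector field on the domain of \<open>c\<close>.\<close>

definition coord_vec ::
    "('m, 'n::finite) chart set \<Rightarrow> ('m, 'n) chart \<Rightarrow> complex^'n \<Rightarrow> 'm \<Rightarrow> ('m, 'n) tvec" where
  "coord_vec M c u x = (\<lambda>c'. if c' \<in> M \<and> x \<in> fst c'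
     then frechet_derivative (snd c' \<circ> chart_inv c) (at (snd c x)) u else 0)"

text \<open>The differential \<open>df\<^sub>x(X)\<close>; by the chain rule it does not depend on the chart chosen.\<close>

definition differential ::
    "('m, 'n::finite) chart set \<Rightarrow> ('m \<Rightarrow> 'b::real_normed_vector) \<Rightarrow> 'm \<Rightarrow> ('m, 'n) tvec \<Rightarrow> 'b" where
  "differential M f x X =
     (let c = (SOME c. c \<in> M \<and> x \<in> fst c)
      in frechet_derivative (f \<circ> chart_inv c) (at (snd c x)) (X c))"


section \<open>Kaehler metrics\<close>

text \<open>A 2-form is evaluated on pairs of tangent vectors. It is closed if
  \<open>d\<omega>(u,v,w) = \<partial>\<^sub>u \<omega>(v,w) - \<partial>\<^sub>v \<omega>(u,w) + \<partial>\<^sub>w \<omega>(u,v)\<close> vanishes for coordinate vector fields.\<close>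

definition closed_2form ::
    "('m, 'n::finite) chart set \<Rightarrow> ('m \<Rightarrow> ('m, 'n) tvec \<Rightarrow> ('m, 'n) tvec \<Rightarrow> real) \<Rightarrow> bool" where
  "closed_2form M \<omega> \<longleftrightarrow> (\<forall>c\<in>M. \<forall>x\<in>fst c. \<forall>u v w.
     (let \<omega>' = (\<lambda>a b y. \<omega> y (coord_vec M c a y) (coord_vec M c b y))
      in differential M (\<omega>' v w) x (coord_vec M c u x)
       - differential M (\<omega>' u w) x (coord_vec M c v x)
       + differential M (\<omega>' u v) x (coord_vec M c w x) = 0))"

definition kaehler_metric ::
    "('m, 'n::finite) chart set \<Rightarrow> ('m \<Rightarrow> ('m, 'n) tvec \<Rightarrow> ('m, 'n) tvec \<Rightarrow> real) \<Rightarrow> bool" where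
  "kaehler_metric M g \<longleftrightarrow>
     (\<forall>x. \<forall>X\<in>tangent_space M x. \<forall>Y\<in>tangent_space M x.
        g x X Y = g x Y X \<and> g x (tangent_J X) (tangent_J Y) = g x X Y \<and>
        (X \<noteq> (\<lambda>_. 0) \<longrightarrow> 0 < g x X X) \<and>
        (\<forall>Z\<in>tangent_space M x. \<forall>a b.
           g x (\<lambda>c. a *\<^sub>R X c + b *\<^sub>R Y c) Z = a * g x X Z + b * g x Y Z)) \<and>
     (\<forall>c\<in>M. \<forall>u v. smooth_fun M (fst c) (\<lambda>x. g x (coord_vec M c u x) (coord_vec M c v x))) \<and>
     closed_2form M (\<lambda>x X Y. g x (tangent_J X) Y)"

definition compact_kaehler_manifold ::
    "('m::{t2_space,second_countable_topology}, 'n::finite) chart set \<Rightarrow>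
     ('m \<Rightarrow> ('m, 'n) tvec \<Rightarrow> ('m, 'n) tvec \<Rightarrow> real) \<Rightarrow> bool" where
  "compact_kaehler_manifold M g \<longleftrightarrow>
     compact (UNIV :: 'm set) \<and> complex_manifold M \<and> kaehler_metric M g"


section \<open>Holomorphic vector bundles\<close>

text \<open>The fibres are complex-linear subspaces of one complex vector space \<open>'v\<close> with scalar
  multiplication \<open>scl\<close>. The ambient space only supplies the vector space operations and is no
  restriction (take the direct sum of all fibres); no relation between different fibres is derived
  from it. The holomorphic structure is given by a collection of local frames, each a domain with
  a list of local sections, equivalently by local trivializations.\<close>

record ('m, 'v) vbundle =
  scl :: "complex \<Rightarrow> 'v \<Rightarrow> 'v"
  fibre :: "'m \<Rightarrow> 'v set"
  frames :: "('m set \<times> ('m \<Rightarrow> 'v) list) set"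

definition lin_comb ::
    "('m, 'v::ab_group_add) vbundle \<Rightarrow> ('m \<Rightarrow> 'v) list \<Rightarrow> (nat \<Rightarrow> 'm \<Rightarrow> complex) \<Rightarrow> 'm \<Rightarrow> 'v" where
  "lin_comb E es f x = (\<Sum>i<length es. scl E (f i x) ((es ! i) x))"

definition frame_on ::
    "('m, 'v::ab_group_add) vbundle \<Rightarrow> ('m \<Rightarrow> 'v set) \<Rightarrow> 'm set \<Rightarrow> ('m \<Rightarrow> 'v) list \<Rightarrow> bool" where
  "frame_on E F U es \<longleftrightarrow> (\<forall>x\<in>U. distinct (map (\<lambda>e. e x) es) \<and>
     \<not> module.dependent (scl E) ((\<lambda>e. e x) ` set es) \<and>
     module.span (scl E) ((\<lambda>e. e x) ` set es) = F x)"

definition smooth_section ::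
    "('m, 'n::finite) chart set \<Rightarrow> ('m, 'v::ab_group_add) vbundle \<Rightarrow> 'm set \<Rightarrow> ('m \<Rightarrow> 'v) \<Rightarrow> bool" where
  "smooth_section M E U s \<longleftrightarrow> (\<forall>x\<in>U. s x \<in> fibre E x) \<and>
     (\<forall>(W, es)\<in>frames E. \<exists>f. (\<forall>i<length es. smooth_fun M (U \<inter> W) (f i)) \<and>
        (\<forall>x\<in>U \<inter> W. s x = lin_comb E es f x))"

definition hol_section ::
    "('m, 'n::finite) chart set \<Rightarrow> ('m, 'v::ab_group_add) vbundle \<Rightarrow> 'm set \<Rightarrow> ('m \<Rightarrow> 'v) \<Rightarrow> bool" where
  "hol_section M E U s \<longleftrightarrow> (\<forall>x\<in>U. s x \<in> fibre E x) \<and>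
     (\<forall>(W, es)\<in>frames E. \<exists>f. (\<forall>i<length es. hol_fun M (U \<inter> W) (f i)) \<and>
        (\<forall>x\<in>U \<inter> W. s x = lin_comb E es f x))"

text \<open>The last condition says that the transition functions between frames are holomorphic.\<close>

definition holomorphic_vector_bundle ::
    "('m::topological_space, 'n::finite) chart set \<Rightarrow> ('m, 'v::ab_group_add) vbundle \<Rightarrow> bool" where
  "holomorphic_vector_bundle M E \<longleftrightarrow>
     vector_space (scl E) \<and>
     (\<forall>x. module.subspace (scl E) (fibre E x)) \<and>
     (\<Union>(U, es)\<in>frames E. U) = UNIV \<and>
     (\<forall>(U, es)\<in>frames E. open U \<and> frame_on E (fibre E) U es \<and> (\<forall>e\<in>set es. hol_section M E U e))"

text \<open>A subbundle is given by the family of its fibres.\<close>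

definition holomorphic_subbundle ::
    "('m::topological_space, 'n::finite) chart set \<Rightarrow> ('m, 'v::ab_group_add) vbundle \<Rightarrow>
     ('m \<Rightarrow> 'v set) \<Rightarrow> bool" where
  "holomorphic_subbundle M E F \<longleftrightarrow>
     (\<forall>x. module.subspace (scl E) (F x) \<and> F x \<subseteq> fibre E x) \<and>
     (\<forall>x. \<exists>U es. open U \<and> x \<in> U \<and> (\<forall>e\<in>set es. hol_section M E U e) \<and> frame_on E F U es)"

definition smooth_section_in ::
    "('m, 'n::finite) chart set \<Rightarrow> ('m, 'v::ab_group_add) vbundle \<Rightarrow> ('m \<Rightarrow> 'v set) \<Rightarrow>
     ('m \<Rightarrow> 'v) \<Rightarrow> bool" where
  "smooth_section_in M E F s \<longleftrightarrow> smooth_section M E UNIV s \<and> (\<forall>x. s x \<in> F x)"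


section \<open>Higgs bundles\<close>

text \<open>Differential forms are evaluated on real tangent vectors: a complex-valued or bundle-valued
  1-form is real-linear there, it has type (1,0) iff it is complex-linear, and type (0,1) iff
  it is conjugate-linear with respect to the complex structure.\<close>

definition one_form ::
    "('m, 'n::finite) chart set \<Rightarrow> ('m, 'v::ab_group_add) vbundle \<Rightarrow>
     ('m \<Rightarrow> ('m, 'n) tvec \<Rightarrow> 'v) \<Rightarrow> bool" where
  "one_form M E \<alpha> \<longleftrightarrow>
     (\<forall>x. \<forall>X\<in>tangent_space M x. \<alpha> x X \<in> fibre E x \<and>
        (\<forall>Y\<in>tangent_space M x. \<forall>a b. \<alpha> x (\<lambda>c. a *\<^sub>R X c + b *\<^sub>R Y c) =
           scl E (of_real a) (\<alpha> x X) + scl E (of_real b) (\<alpha> x Y))) \<and>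
     (\<forall>c\<in>M. \<forall>u. smooth_section M E (fst c) (\<lambda>x. \<alpha> x (coord_vec M c u x)))"

definition part01 ::
    "(complex \<Rightarrow> 'w::ab_group_add \<Rightarrow> 'w) \<Rightarrow> ('m \<Rightarrow> ('m, 'n::finite) tvec \<Rightarrow> 'w) \<Rightarrow>
     'm \<Rightarrow> ('m, 'n) tvec \<Rightarrow> 'w" where
  "part01 sc \<alpha> x X = sc (1/2) (\<alpha> x X + sc \<i> (\<alpha> x (tangent_J X)))"

type_synonym ('m, 'n, 'v) end_form = "'m \<Rightarrow> ('m, 'n) tvec \<Rightarrow> 'v \<Rightarrow> 'v"

definition end_form10 ::
    "('m::topological_space, 'n::finite) chart set \<Rightarrow> ('m, 'v::ab_group_add) vbundle \<Rightarrow>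
     ('m, 'n, 'v) end_form \<Rightarrow> bool" where
  "end_form10 M E \<Phi> \<longleftrightarrow>
     (\<forall>x. \<forall>X\<in>tangent_space M x. \<forall>v\<in>fibre E x. \<Phi> x X v \<in> fibre E x \<and>
        (\<forall>w\<in>fibre E x. \<forall>a b. \<Phi> x X (scl E a v + scl E b w) =
           scl E a (\<Phi> x X v) + scl E b (\<Phi> x X w)) \<and>
        (\<forall>Y\<in>tangent_space M x. \<forall>a b. \<Phi> x (\<lambda>c. a *s X c + b *s Y c) v =
           scl E a (\<Phi> x X v) + scl E b (\<Phi> x Y v))) \<and>
     (\<forall>U s. open U \<longrightarrow> smooth_section M E U s \<longrightarrow> (\<forall>c\<in>M. \<forall>u.
        smooth_section M E (U \<inter> fst c) (\<lambda>x. \<Phi> x (coord_vec M c u x) (s x))))"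

definition hol_end_form ::
    "('m::topological_space, 'n::finite) chart set \<Rightarrow> ('m, 'v::ab_group_add) vbundle \<Rightarrow>
     ('m, 'n, 'v) end_form \<Rightarrow> bool" where
  "hol_end_form M E \<Phi> \<longleftrightarrow>
     (\<forall>U s. open U \<longrightarrow> hol_section M E U s \<longrightarrow> (\<forall>c\<in>M. \<forall>u.
        hol_section M E (U \<inter> fst c) (\<lambda>x. \<Phi> x (coord_vec M c u x) (s x))))"

definition end_wedge ::
    "('m, 'n, 'v::ab_group_add) end_form \<Rightarrow> ('m, 'n, 'v) end_form \<Rightarrow>
     'm \<Rightarrow> ('m, 'n) tvec \<Rightarrow> ('m, 'n) tvec \<Rightarrow> 'v \<Rightarrow> 'v" where
  "end_wedge \<Phi> \<Psi> x X Y v = \<Phi> x X (\<Psi> x Y v) - \<Phi> x Y (\<Psi> x X v)"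

definition higgs_bundle ::
    "('m::topological_space, 'n::finite) chart set \<Rightarrow> ('m, 'v::ab_group_add) vbundle \<Rightarrow>
     ('m, 'n, 'v) end_form \<Rightarrow> bool" where
  "higgs_bundle M E \<Phi> \<longleftrightarrow>
     holomorphic_vector_bundle M E \<and> end_form10 M E \<Phi> \<and> hol_end_form M E \<Phi> \<and>
     (\<forall>x. \<forall>X\<in>tangent_space M x. \<forall>Y\<in>tangent_space M x. \<forall>v\<in>fibre E x.
        end_wedge \<Phi> \<Phi> x X Y v = 0)"

definition hermitian_metric ::
    "('m::topological_space, 'n::finite) chart set \<Rightarrow> ('m, 'v::ab_group_add) vbundle \<Rightarrow>
     ('m \<Rightarrow> 'v \<Rightarrow> 'v \<Rightarrow> complex) \<Rightarrow> bool" where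
  "hermitian_metric M E h \<longleftrightarrow>
     (\<forall>x. \<forall>v\<in>fibre E x. \<forall>w\<in>fibre E x. h x w v = cnj (h x v w) \<and>
        (v \<noteq> 0 \<longrightarrow> 0 < Re (h x v v)) \<and>
        (\<forall>t\<in>fibre E x. \<forall>a b. h x (scl E a v + scl E b w) t = a * h x v t + b * h x w t)) \<and>
     (\<forall>U s t. open U \<longrightarrow> smooth_section M E U s \<longrightarrow> smooth_section M E U t \<longrightarrow>
        smooth_fun M U (\<lambda>x. h x (s x) (t x)))"

definition hermitian_higgs_bundle ::
    "('m::topological_space, 'n::finite) chart set \<Rightarrow> ('m, 'v::ab_group_add) vbundle \<Rightarrow>
     ('m, 'n, 'v) end_form \<Rightarrow> ('m \<Rightarrow> 'v \<Rightarrow> 'v \<Rightarrow> complex) \<Rightarrow> bool" where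
  "hermitian_higgs_bundle M E \<Phi> h \<longleftrightarrow> higgs_bundle M E \<Phi> \<and> hermitian_metric M E h"

text \<open>On a real tangent vector \<open>X\<close>, the form part of \<open>h(\<xi>, \<Phi>\<eta>)\<close> is conjugated along with the
  endomorphism part, so the hermitian conjugate of \<open>\<Phi>\<close> evaluated at \<open>X\<close> is the adjoint of
  \<open>\<Phi>(X)\<close>; as \<open>\<Phi>\<close> is of type (1,0), it is of type (0,1).\<close>

definition hermitian_conjugate ::
    "('m, 'v::ab_group_add) vbundle \<Rightarrow> ('m \<Rightarrow> 'v \<Rightarrow> 'v \<Rightarrow> complex) \<Rightarrow>
     ('m, 'n::finite, 'v) end_form \<Rightarrow> ('m, 'n, 'v) end_form" where
  "hermitian_conjugate E h \<Phi> x X \<xi> =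
     (THE \<zeta>. \<zeta> \<in> fibre E x \<and> (\<forall>\<eta>\<in>fibre E x. h x \<zeta> \<eta> = h x \<xi> (\<Phi> x X \<eta>)))"

definition orthogonal_complement ::
    "('m, 'v::ab_group_add) vbundle \<Rightarrow> ('m \<Rightarrow> 'v \<Rightarrow> 'v \<Rightarrow> complex) \<Rightarrow>
     ('m \<Rightarrow> 'v set) \<Rightarrow> 'm \<Rightarrow> 'v set" where
  "orthogonal_complement E h S x = {v \<in> fibre E x. \<forall>s\<in>S x. h x v s = 0}"

definition invariant_under ::
    "('m, 'n::finite) chart set \<Rightarrow> ('m, 'n, 'v) end_form \<Rightarrow> ('m \<Rightarrow> 'v set) \<Rightarrow> bool" where
  "invariant_under M \<Psi> F \<longleftrightarrow> (\<forall>x. \<forall>X\<in>tangent_space M x. \<forall>v\<in>F x. \<Psi> x X v \<in> F x)"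

definition higgs_subbundle ::
    "('m::topological_space, 'n::finite) chart set \<Rightarrow> ('m, 'v::ab_group_add) vbundle \<Rightarrow>
     ('m, 'n, 'v) end_form \<Rightarrow> ('m \<Rightarrow> 'v set) \<Rightarrow> bool" where
  "higgs_subbundle M E \<Phi> F \<longleftrightarrow> holomorphic_subbundle M E F \<and> invariant_under M \<Phi> F"

definition holomorphic_direct_sum ::
    "('m::topological_space, 'n::finite) chart set \<Rightarrow> ('m, 'v::ab_group_add) vbundle \<Rightarrow>
     ('m \<Rightarrow> 'v set) \<Rightarrow> ('m \<Rightarrow> 'v set) \<Rightarrow> bool" where
  "holomorphic_direct_sum M E F G \<longleftrightarrow>
     holomorphic_subbundle M E F \<and> holomorphic_subbundle M E G \<and>
     (\<forall>x. F x \<inter> G x = {0} \<and> fibre E x = {v + w | v w. v \<in> F x \<and> w \<in> G x})"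

definition higgs_orthogonal_decomposition ::
    "('m::topological_space, 'n::finite) chart set \<Rightarrow> ('m, 'v::ab_group_add) vbundle \<Rightarrow>
     ('m, 'n, 'v) end_form \<Rightarrow> ('m \<Rightarrow> 'v \<Rightarrow> 'v \<Rightarrow> complex) \<Rightarrow>
     ('m \<Rightarrow> 'v set) \<Rightarrow> ('m \<Rightarrow> 'v set) \<Rightarrow> bool" where
  "higgs_orthogonal_decomposition M E \<Phi> h F G \<longleftrightarrow>
     holomorphic_direct_sum M E F G \<and>
     (\<forall>x. \<forall>v\<in>F x. \<forall>w\<in>G x. h x v w = 0) \<and>
     higgs_subbundle M E \<Phi> F \<and> higgs_subbundle M E \<Phi> G"


section \<open>Chern connection and second fundamental form\<close>

text \<open>A connection maps global smooth sections to bundle-valued 1-forms; forms are compared on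
  tangent vectors only.\<close>

definition connection ::
    "('m::topological_space, 'n::finite) chart set \<Rightarrow> ('m, 'v::ab_group_add) vbundle \<Rightarrow>
     (('m \<Rightarrow> 'v) \<Rightarrow> 'm \<Rightarrow> ('m, 'n) tvec \<Rightarrow> 'v) \<Rightarrow> bool" where
  "connection M E D \<longleftrightarrow>
     (\<forall>s. smooth_section M E UNIV s \<longrightarrow> one_form M E (D s)) \<and>
     (\<forall>s t. smooth_section M E UNIV s \<longrightarrow> smooth_section M E UNIV t \<longrightarrow>
        (\<forall>x. \<forall>X\<in>tangent_space M x. D (\<lambda>y. s y + t y) x X = D s x X + D t x X)) \<and>
     (\<forall>f s. smooth_fun M UNIV f \<longrightarrow> smooth_section M E UNIV s \<longrightarrow>
        (\<forall>x. \<forall>X\<in>tangent_space M x. D (\<lambda>y. scl E (f y) (s y)) x X =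
           scl E (differential M f x X) (s x) + scl E (f x) (D s x X)))"

definition metric_connection ::
    "('m::topological_space, 'n::finite) chart set \<Rightarrow> ('m, 'v::ab_group_add) vbundle \<Rightarrow>
     ('m \<Rightarrow> 'v \<Rightarrow> 'v \<Rightarrow> complex) \<Rightarrow> (('m \<Rightarrow> 'v) \<Rightarrow> 'm \<Rightarrow> ('m, 'n) tvec \<Rightarrow> 'v) \<Rightarrow> bool" where
  "metric_connection M E h D \<longleftrightarrow> connection M E D \<and>
     (\<forall>s t. smooth_section M E UNIV s \<longrightarrow> smooth_section M E UNIV t \<longrightarrow>
        (\<forall>x. \<forall>X\<in>tangent_space M x. differential M (\<lambda>y. h y (s y) (t y)) x X =
           h x (D s x X) (t x) + h x (s x) (D t x X)))"

text \<open>The (0,1)-part of the Chern connection is the Dolbeault operator of \<open>E\<close>, which maps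
  \<open>\<Sum>\<^sub>i f\<^sub>i e\<^sub>i\<close>, for a holomorphic frame \<open>e\<^sub>i\<close>, to the sum of the \<open>e\<^sub>i\<close> with the (0,1)-parts
  of the \<open>df\<^sub>i\<close> as coefficients.\<close>

definition chern_connection ::
    "('m::topological_space, 'n::finite) chart set \<Rightarrow> ('m, 'v::ab_group_add) vbundle \<Rightarrow>
     ('m \<Rightarrow> 'v \<Rightarrow> 'v \<Rightarrow> complex) \<Rightarrow> (('m \<Rightarrow> 'v) \<Rightarrow> 'm \<Rightarrow> ('m, 'n) tvec \<Rightarrow> 'v) \<Rightarrow> bool" where
  "chern_connection M E h D \<longleftrightarrow> metric_connection M E h D \<and>
     (\<forall>s. smooth_section M E UNIV s \<longrightarrow> (\<forall>(U, es)\<in>frames E. \<forall>f.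
        (\<forall>i<length es. smooth_fun M U (f i)) \<longrightarrow> (\<forall>x\<in>U. s x = lin_comb E es f x) \<longrightarrow>
        (\<forall>x\<in>U. \<forall>X\<in>tangent_space M x. part01 (scl E) (D s) x X =
           lin_comb E es (\<lambda>i y. part01 (*) (differential M (f i)) y X) x)))"

text \<open>\<open>A\<^sub>h \<xi>\<close> is the component of \<open>D\<^sub>h \<xi>\<close> in the orthogonal complement of \<open>S\<close>.\<close>

definition second_fundamental_form ::
    "('m, 'v::ab_group_add) vbundle \<Rightarrow> ('m \<Rightarrow> 'v \<Rightarrow> 'v \<Rightarrow> complex) \<Rightarrow>
     (('m \<Rightarrow> 'v) \<Rightarrow> 'm \<Rightarrow> ('m, 'n::finite) tvec \<Rightarrow> 'v) \<Rightarrow> ('m \<Rightarrow> 'v set) \<Rightarrow>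
     ('m \<Rightarrow> 'v) \<Rightarrow> 'm \<Rightarrow> ('m, 'n) tvec \<Rightarrow> 'v" where
  "second_fundamental_form E h D S \<xi> x X =
     (THE \<eta>. \<eta> \<in> orthogonal_complement E h S x \<and> (\<exists>\<sigma>\<in>S x. D \<xi> x X = \<sigma> + \<eta>))"

end

theory Submission
  imports Defs
begin

text \<open>
  The decomposition \<open>E = S \<oplus> S\<^sup>\<bottom>\<close> holds fibrewise by orthogonal projection. That \<open>S\<^sup>\<bottom>\<close> is
  \<open>\<Phi>\<close>-invariant is linear algebra in the fibres: it is the adjoint statement to the invariance of
  \<open>S\<close> under the hermitian conjugate (\<open>orthogonal_complement_invariant\<close>). The essential point is that
  \<open>S\<^sup>\<bottom>\<close> is a holomorphic subbundle.

  As the second fundamental form vanishes, the Chern connection \<open>D\<close> maps sections of \<open>S\<close> to forms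
  with values in \<open>S\<close>, and by compatibility with the metric it also maps sections of \<open>S\<^sup>\<bottom>\<close> to forms
  with values in \<open>S\<^sup>\<bottom>\<close> (\<open>D_preserves_S\<close>, \<open>D_preserves_S_perp\<close>). The same is then true of the
  Dolbeault operator, the (0,1)-part of \<open>D\<close> (\<open>dbar_preserves\<close>). Decompose a local holomorphic section
  as \<open>e = p + q\<close> with \<open>p\<close> in \<open>S\<close> and \<open>q\<close> in \<open>S\<^sup>\<bottom>\<close>. The Dolbeault operator annihilates the sum and
  respects both summands, so it annihilates \<open>q\<close>, which is therefore holomorphic
  (\<open>hol_section_orthogonal_part\<close>). The components \<open>q\<close> of a holomorphic frame of \<open>E\<close> span \<open>S\<^sup>\<bottom>\<close>, and a
  suitable choice among them is a local holomorphic frame (\<open>S_perp_subbundle\<close>).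

  Two tools make this precise. The Gram-Schmidt process for local sections (\<open>local_Gram_Schmidt\<close>)
  shows that the projection onto \<open>S\<close> is smooth and that linear independence at a point persists
  nearby, which avoids determinants. Since \<open>D\<close> acts on global sections only, local sections are
  extended by means of bump functions (\<open>bump_function\<close>), built from the flat functions
  \<open>t\<^sup>-\<^sup>n exp (-1/t)\<close>.
\<close>

section \<open>Calculus of smooth functions\<close>

lemma Ck_on_subset: "Ck_on k U f \<Longrightarrow> V \<subseteq> U \<Longrightarrow> Ck_on k V f"
  by (induction k arbitrary: f) (auto intro: continuous_on_subset)

lemma Ck_on_cong:
  assumes "open U" "\<And>x. x \<in> U \<Longrightarrow> f x = g x"
  shows "Ck_on k U f \<longleftrightarrow> Ck_on k U g"
  using assms(2)
proof (induction k arbitrary: f g)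
  case 0
  then show ?case by (auto intro: continuous_on_cong)
next
  case (Suc k)
  have d: "p differentiable (at x) \<Longrightarrow> q differentiable (at x)"
    if "x \<in> U" "\<And>x. x \<in> U \<Longrightarrow> p x = q x" for p q :: "'a \<Rightarrow> 'b" and x
    using that assms(1) unfolding differentiable_def
    by (meson has_derivative_transform_within_open)
  have e: "frechet_derivative f (at x) = frechet_derivative g (at x)"
    if "x \<in> U" "\<forall>x\<in>U. f differentiable (at x)" for x
    using frechet_derivative_transform_within_open[OF _ assms(1) that(1), of f g] that Suc.prems by auto
  have "Ck_on k U (\<lambda>x. frechet_derivative f (at x) v) = Ck_on k U (\<lambda>x. frechet_derivative g (at x) v)"
    if "\<forall>x\<in>U. f differentiable (at x)" for v
    by (rule Suc.IH) (use that e in auto)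
  moreover have "(\<forall>x\<in>U. f differentiable (at x)) \<longleftrightarrow> (\<forall>x\<in>U. g differentiable (at x))"
    using d Suc.prems by metis
  ultimately show ?case by auto
qed

lemma Ck_on_SucI:
  assumes "open U" "\<And>x. x \<in> U \<Longrightarrow> (f has_derivative f' x) (at x)"
    and "\<And>v. Ck_on k U (\<lambda>x. f' x v)"
  shows "Ck_on (Suc k) U f"
proof -
  have e: "frechet_derivative f (at x) = f' x" if "x \<in> U" for x
    using frechet_derivative_at[OF assms(2)[OF that]] by simp
  have "Ck_on k U (\<lambda>x. frechet_derivative f (at x) v)" for v
    using Ck_on_cong[OF assms(1), of "\<lambda>x. frechet_derivative f (at x) v" "\<lambda>x. f' x v" k] e assms(3)
    by auto
  then show ?thesis using assms(2) by (auto simp: differentiable_def)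
qed

lemma Ck_on_SucD:
  assumes "Ck_on (Suc k) U f"
  shows "x \<in> U \<Longrightarrow> (f has_derivative frechet_derivative f (at x)) (at x)"
    and "Ck_on k U (\<lambda>x. frechet_derivative f (at x) v)"
  using assms frechet_derivative_works by auto

lemma Ck_on_Suc_imp: "Ck_on (Suc k) U f \<Longrightarrow> Ck_on k U f"
proof (induction k arbitrary: f)
  case 0
  then show ?case
    by (auto intro!: continuous_at_imp_continuous_on differentiable_imp_continuous_within)
next
  case (Suc k)
  then show ?case by auto
qed

lemma Ck_on_const: "Ck_on k U (\<lambda>x. c)"
  by (induction k arbitrary: c) (auto simp: frechet_derivative_const)

lemma Ck_on_bounded_linear:
  assumes "bounded_linear L" "open U" "Ck_on k U f"
  shows "Ck_on k U (\<lambda>x. L (f x))"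
  using assms(3)
proof (induction k arbitrary: f)
  case 0
  then show ?case
    using bounded_linear.continuous_on[OF assms(1)] by auto
next
  case (Suc k)
  show ?case
  proof (rule Ck_on_SucI[OF assms(2)])
    show "((\<lambda>x. L (f x)) has_derivative (\<lambda>v. L (frechet_derivative f (at x) v))) (at x)"
      if "x \<in> U" for x
      using bounded_linear.has_derivative[OF assms(1) Ck_on_SucD(1)[OF Suc.prems that]] .
    show "Ck_on k U (\<lambda>x. L (frechet_derivative f (at x) v))" for v
      by (rule Suc.IH[OF Ck_on_SucD(2)[OF Suc.prems]])
  qed
qed

lemma Ck_on_add:
  assumes "open U" "Ck_on k U f" "Ck_on k U g"
  shows "Ck_on k U (\<lambda>x. f x + g x)"
  using assms(2,3)
proof (induction k arbitrary: f g)
  case 0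
  then show ?case by (auto intro: continuous_on_add)
next
  case (Suc k)
  show ?case
  proof (rule Ck_on_SucI[OF assms(1)])
    show "((\<lambda>x. f x + g x) has_derivative
        (\<lambda>v. frechet_derivative f (at x) v + frechet_derivative g (at x) v)) (at x)"
      if "x \<in> U" for x
      using has_derivative_add[OF Ck_on_SucD(1)[OF Suc.prems(1) that]
          Ck_on_SucD(1)[OF Suc.prems(2) that]] .
    show "Ck_on k U (\<lambda>x. frechet_derivative f (at x) v + frechet_derivative g (at x) v)" for v
      by (rule Suc.IH[OF Ck_on_SucD(2)[OF Suc.prems(1)] Ck_on_SucD(2)[OF Suc.prems(2)]])
  qed
qed

lemma Ck_on_bilinear:
  assumes "bounded_bilinear B" "open U" "Ck_on k U f" "Ck_on k U g"
  shows "Ck_on k U (\<lambda>x. B (f x) (g x))"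
  using assms(3,4)
proof (induction k arbitrary: f g)
  case 0
  then show ?case using bounded_bilinear.continuous_on[OF assms(1)] by auto
next
  case (Suc k)
  show ?case
  proof (rule Ck_on_SucI[OF assms(2)])
    show "((\<lambda>x. B (f x) (g x)) has_derivative
        (\<lambda>v. B (f x) (frechet_derivative g (at x) v) + B (frechet_derivative f (at x) v) (g x))) (at x)"
      if "x \<in> U" for x
      using bounded_bilinear.FDERIV[OF assms(1) Ck_on_SucD(1)[OF Suc.prems(1) that]
          Ck_on_SucD(1)[OF Suc.prems(2) that]] .
    show "Ck_on k U (\<lambda>x. B (f x) (frechet_derivative g (at x) v)
        + B (frechet_derivative f (at x) v) (g x))" for v
      by (intro Ck_on_add assms Suc.IH Ck_on_SucD(2)[OF Suc.prems(1)]
          Ck_on_SucD(2)[OF Suc.prems(2)] Ck_on_Suc_imp[OF Suc.prems(1)] Ck_on_Suc_imp[OF Suc.prems(2)])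
  qed
qed

lemma Ck_on_inverse:
  fixes f :: "'a::real_normed_vector \<Rightarrow> complex"
  assumes "open U" "\<And>x. x \<in> U \<Longrightarrow> f x \<noteq> 0" "Ck_on k U f"
  shows "Ck_on k U (\<lambda>x. inverse (f x))"
  using assms(3)
proof (induction k)
  case 0
  then show ?case using assms(2) by (auto intro: continuous_on_inverse)
next
  case (Suc k)
  have inv: "Ck_on k U (\<lambda>x. inverse (f x))"
    by (rule Suc.IH[OF Ck_on_Suc_imp[OF Suc.prems]])
  show ?case
  proof (rule Ck_on_SucI[OF assms(1)])
    show "((\<lambda>x. inverse (f x)) has_derivative
        (\<lambda>v. - (inverse (f x) * frechet_derivative f (at x) v * inverse (f x)))) (at x)"
      if "x \<in> U" for x
      using Deriv.has_derivative_inverse[OF assms(2)[OF that] Ck_on_SucD(1)[OF Suc.prems that]] .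
    show "Ck_on k U (\<lambda>x. - (inverse (f x) * frechet_derivative f (at x) v * inverse (f x)))" for v
      by (intro Ck_on_bounded_linear[OF bounded_linear_minus[OF bounded_linear_ident]]
          Ck_on_bilinear[OF bounded_bilinear_mult] assms inv Ck_on_SucD(2)[OF Suc.prems])
  qed
qed

lemma Ck_on_Un:
  assumes "open U" "open V" "Ck_on k U f" "Ck_on k V f"
  shows "Ck_on k (U \<union> V) f"
  using assms(3,4)
proof (induction k arbitrary: f)
  case 0
  then show ?case using continuous_on_open_Un assms by auto
qed auto

lemma Cinf_on_differentiable: "Cinf_on U f \<Longrightarrow> x \<in> U \<Longrightarrow> f differentiable (at x)"
  unfolding Cinf_on_def by (metis Ck_on.simps(2))

lemma Cinf_on_frechet:
  "Cinf_on U f \<Longrightarrow> x \<in> U \<Longrightarrow> (f has_derivative frechet_derivative f (at x)) (at x)"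
  using Cinf_on_differentiable frechet_derivative_works by blast

lemma Cinf_on_continuous: "Cinf_on U f \<Longrightarrow> continuous_on U f"
  unfolding Cinf_on_def by (metis Ck_on.simps(1))

subsection \<open>Flat functions\<close>

text \<open>For each \<open>n\<close>, the function that is \<open>t\<^sup>-\<^sup>n exp (-1/t)\<close> for \<open>t > 0\<close> and \<open>0\<close> elsewhere. This
  family is closed under differentiation up to linear combinations, so that all its members are
  smooth.\<close>

definition flat :: "nat \<Rightarrow> real \<Rightarrow> real" where
  "flat n t = (if 0 < t then inverse t ^ n * exp (- inverse t) else 0)"

lemma flat_tendsto_0: "(flat n \<longlongrightarrow> 0) (at 0)"
proof -
  have "((\<lambda>s::real. s ^ n * exp (- s)) \<longlongrightarrow> 0) at_top"
    using tendsto_power_div_exp_0[of n] by (simp add: exp_minus divide_inverse)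
  then have "((\<lambda>t::real. inverse t ^ n * exp (- inverse t)) \<longlongrightarrow> 0) (at_right 0)"
    using filterlim_compose[OF _ filterlim_inverse_at_top_right] by fastforce
  then have "(flat n \<longlongrightarrow> 0) (at_right 0)"
    by (rule Lim_transform_eventually)
      (auto simp: flat_def eventually_at_filter intro!: always_eventually)
  moreover have "(flat n \<longlongrightarrow> 0) (at_left 0)"
    by (rule Lim_transform_eventually[OF tendsto_const])
      (auto simp: flat_def eventually_at_filter intro!: always_eventually)
  ultimately show ?thesis by (simp add: filterlim_at_split)
qed

lemma flat_derivative:
  "(flat n has_real_derivative flat (n + 2) t - real n * flat (n + 1) t) (at t)"
proof -
  consider "t > 0" | "t < 0" | "t = 0" by linarith
  then show ?thesis
  proof cases
    case 1
    have "((\<lambda>t. inverse t ^ n * exp (- inverse t)) has_real_derivative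
        flat (n + 2) t - real n * flat (n + 1) t) (at t)"
      using 1 by (auto intro!: derivative_eq_intros simp: flat_def field_simps power2_eq_square)
        (cases n; simp add: field_simps)
    then show ?thesis
      by (rule DERIV_cong_ev[THEN iffD1, rotated -1])
        (use 1 in \<open>auto simp: flat_def intro: eventually_mono[OF eventually_gt_at_top]
          eventually_nhds_in_open[of "{0<..}", THEN eventually_mono]\<close>)
  next
    case 2
    have "((\<lambda>t. 0) has_real_derivative flat (n + 2) t - real n * flat (n + 1) t) (at t)"
      using 2 by (simp add: flat_def)
    then show ?thesis
      by (rule DERIV_cong_ev[THEN iffD1, rotated -1])
        (use 2 in \<open>auto simp: flat_def eventually_nhds intro!: exI[of _ "{..<0}"]\<close>)
  next
    case 3
    \<comment> \<open>The difference quotient of \<open>flat n\<close> at \<open>0\<close> is \<open>flat (n + 1)\<close>.\<close>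
    have "flat (Suc n) = (\<lambda>s. flat n s / s)"
      by (rule ext) (auto simp: flat_def field_simps)
    then have "((\<lambda>s. flat n s / s) \<longlongrightarrow> 0) (at 0)"
      using flat_tendsto_0[of "Suc n"] by simp
    then show ?thesis
      using 3 by (simp add: has_field_derivative_iff flat_def)
  qed
qed

text \<open>Composition with a smooth \<open>\<rho>\<close>: the derivative in a direction \<open>v\<close> is the product of
  \<open>\<partial>\<^sub>v\<rho>\<close> with a combination of members of the same family composed with \<open>\<rho>\<close>, so induction on \<open>k\<close>
  for all \<open>n\<close> at once replaces a general chain rule for \<open>C\<^sup>k\<close> maps.\<close>

lemma Ck_on_flat:
  assumes "open U" "Cinf_on U \<rho>"
  shows "Ck_on k U (\<lambda>x. flat n (\<rho> x))"
proof (induction k arbitrary: n)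
  case 0
  have "continuous_on UNIV (flat n)"
    using flat_derivative[of n] by (auto intro!: DERIV_continuous_on)
  then show ?case
    using continuous_on_compose2[of UNIV "flat n" U \<rho>] Cinf_on_continuous[OF assms(2)] by simp
next
  case (Suc k)
  show ?case
  proof (rule Ck_on_SucI[OF assms(1)])
    show "((\<lambda>x. flat n (\<rho> x)) has_derivative
        (\<lambda>v. (flat (n + 2) (\<rho> x) + (- real n) * flat (n + 1) (\<rho> x)) * frechet_derivative \<rho> (at x) v)) (at x)"
      if "x \<in> U" for x
      using has_derivative_compose[OF Cinf_on_frechet[OF assms(2) that]
          flat_derivative[of n "\<rho> x", THEN has_field_derivative_imp_has_derivative]]
      by simp
    have "Ck_on (Suc k) U \<rho>" using assms(2) unfolding Cinf_on_def by blast
    from Ck_on_SucD(2)[OF this]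
    show "Ck_on k U (\<lambda>x. (flat (n + 2) (\<rho> x) + (- real n) * flat (n + 1) (\<rho> x)) * frechet_derivative \<rho> (at x) v)" for v
      by (intro Ck_on_bilinear[OF bounded_bilinear_mult] Ck_on_add Ck_on_const assms(1) Suc.IH)
  qed
qed

section \<open>Functions on a complex manifold\<close>

text \<open>A complex manifold, with atlas \<open>M\<close>.\<close>

locale complex_mfd =
  fixes M :: "('m::{t2_space,second_countable_topology}, 'n::finite) chart set"
  assumes mfd: "complex_manifold M"
begin

lemma chart_ex: "\<exists>c\<in>M. x \<in> fst c"
  using mfd unfolding complex_manifold_def by blast

lemma chart_open: "c \<in> M \<Longrightarrow> open (fst c)"
  using mfd unfolding complex_manifold_def by blast

lemma chart_homeo:
  "c \<in> M \<Longrightarrow> homeomorphism (fst c) (snd c ` fst c) (snd c) (chart_inv c)"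
  using mfd unfolding complex_manifold_def by blast

lemma chart_inv_apply [simp]: "c \<in> M \<Longrightarrow> x \<in> fst c \<Longrightarrow> chart_inv c (snd c x) = x"
  using homeomorphism_apply1[OF chart_homeo] by blast

text \<open>The same for a chart in the form of an explicit pair.\<close>

lemma chart_inv_apply_pair [simp]: "(U, \<phi>) \<in> M \<Longrightarrow> x \<in> U \<Longrightarrow> inv_into U \<phi> (\<phi> x) = x"
  using chart_inv_apply[of "(U, \<phi>)"] by simp

lemma open_chart_image:
  assumes "c \<in> M" "open U"
  shows "open (snd c ` (U \<inter> fst c))"
proof -
  have o: "open (snd c ` fst c)"
    using mfd assms unfolding complex_manifold_def by blast
  have "continuous_on (snd c ` fst c) (chart_inv c)"
    using chart_homeo[OF assms(1)] by (simp add: homeomorphism_def)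
  then have "open (chart_inv c -` U \<inter> snd c ` fst c)"
    using continuous_on_open_vimage[OF o] assms(2) by blast
  also have "chart_inv c -` U \<inter> snd c ` fst c = snd c ` (U \<inter> fst c)"
    using assms(1) by auto
  finally show ?thesis .
qed

lemma transition_hol:
  "c \<in> M \<Longrightarrow> c' \<in> M \<Longrightarrow> hol_on (snd c ` (fst c \<inter> fst c')) (\<lambda>z. snd c' (chart_inv c z) $ k)"
  using mfd unfolding complex_manifold_def by blast

lemma transition_derivative:
  assumes "c \<in> M" "c' \<in> M" "x \<in> fst c" "x \<in> fst c'"
  shows "(snd c' \<circ> chart_inv c has_derivative
      frechet_derivative (snd c' \<circ> chart_inv c) (at (snd c x))) (at (snd c x))"
    and "frechet_derivative (snd c' \<circ> chart_inv c) (at (snd c x)) (\<i> *s v) =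
      \<i> *s frechet_derivative (snd c' \<circ> chart_inv c) (at (snd c x)) v"
proof -
  let ?t = "\<lambda>k z. snd c' (chart_inv c z) $ k"
  have x: "snd c x \<in> snd c ` (fst c \<inter> fst c')" using assms by blast
  have hol: "Cinf_on (snd c ` (fst c \<inter> fst c')) (?t k)"
     "frechet_derivative (?t k) (at (snd c x)) (\<i> *s v) = \<i> * frechet_derivative (?t k) (at (snd c x)) v"
     for k v
    using transition_hol[OF assms(1,2), of k] x unfolding hol_on_def by auto
  have d: "(snd c' \<circ> chart_inv c has_derivative (\<lambda>v. \<chi> k. frechet_derivative (?t k) (at (snd c x)) v))
      (at (snd c x))"
  proof (rule has_derivative_componentwise_within[THEN iffD2], rule ballI)
    fix b :: "complex^'n" assume "b \<in> Basis"
    then obtain k a where b: "b = axis k a" unfolding Basis_vec_def by blast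
    show "((\<lambda>z. (snd c' \<circ> chart_inv c) z \<bullet> b) has_derivative
        (\<lambda>v. (\<chi> k. frechet_derivative (?t k) (at (snd c x)) v) \<bullet> b)) (at (snd c x))"
      using has_derivative_inner_left[OF Cinf_on_frechet[OF hol(1)[of k] x], of a]
      unfolding b by (simp add: inner_axis)
  qed
  show "(snd c' \<circ> chart_inv c has_derivative
      frechet_derivative (snd c' \<circ> chart_inv c) (at (snd c x))) (at (snd c x))"
    using frechet_derivative_at[OF d] d by simp
  show "frechet_derivative (snd c' \<circ> chart_inv c) (at (snd c x)) (\<i> *s v) =
      \<i> *s frechet_derivative (snd c' \<circ> chart_inv c) (at (snd c x)) v"
    unfolding frechet_derivative_at[OF d, symmetric] using hol(2) by (simp add: vec_eq_iff)
qed

lemma smooth_fun_Ck: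
  "smooth_fun M U f \<longleftrightarrow> (\<forall>c\<in>M. \<forall>k. Ck_on k (snd c ` (U \<inter> fst c)) (\<lambda>z. f (chart_inv c z)))"
  by (auto simp: smooth_fun_def Cinf_on_def o_def)

lemma smooth_fun_subset:
  assumes "smooth_fun M U f" "V \<subseteq> U"
  shows "smooth_fun M V f"
  unfolding smooth_fun_Ck
proof (intro ballI allI)
  show "Ck_on k (snd c ` (V \<inter> fst c)) (\<lambda>z. f (chart_inv c z))" if "c \<in> M" for c k
    by (rule Ck_on_subset[of _ "snd c ` (U \<inter> fst c)"])
      (use assms that in \<open>auto simp: smooth_fun_Ck\<close>)
qed

lemma hol_fun_subset:
  assumes "hol_fun M U f" "V \<subseteq> U"
  shows "hol_fun M V f"
  unfolding hol_fun_def
proof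
  fix c assume c: "c \<in> M"
  have sub: "snd c ` (V \<inter> fst c) \<subseteq> snd c ` (U \<inter> fst c)" using assms(2) by blast
  have "hol_on (snd c ` (U \<inter> fst c)) (f \<circ> chart_inv c)"
    using assms(1) c by (simp add: hol_fun_def)
  then show "hol_on (snd c ` (V \<inter> fst c)) (f \<circ> chart_inv c)"
    unfolding hol_on_def Cinf_on_def using sub Ck_on_subset[OF _ sub] by blast
qed

lemma hol_fun_smooth: "hol_fun M U f \<Longrightarrow> smooth_fun M U f"
  unfolding hol_fun_def smooth_fun_def hol_on_def by blast

lemma smooth_fun_cong:
  assumes "open U" "\<And>x. x \<in> U \<Longrightarrow> f x = g x"
  shows "smooth_fun M U f \<longleftrightarrow> smooth_fun M U g"
  unfolding smooth_fun_Ck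
  by (intro ball_cong all_cong1 refl Ck_on_cong open_chart_image assms(1))
    (use assms(2) in auto)

lemma smooth_fun_Un:
  assumes "open U" "open V" "smooth_fun M U f" "smooth_fun M V f"
  shows "smooth_fun M (U \<union> V) f"
  unfolding smooth_fun_Ck
proof (intro ballI allI)
  fix c k assume c: "c \<in> M"
  have "snd c ` ((U \<union> V) \<inter> fst c) = snd c ` (U \<inter> fst c) \<union> snd c ` (V \<inter> fst c)" by blast
  then show "Ck_on k (snd c ` ((U \<union> V) \<inter> fst c)) (\<lambda>z. f (chart_inv c z))"
    using Ck_on_Un[OF open_chart_image[OF c assms(1)] open_chart_image[OF c assms(2)]] assms(3,4) c
    unfolding smooth_fun_Ck by metis
qed

lemma smooth_fun_const: "smooth_fun M U (\<lambda>x. c)"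
  unfolding smooth_fun_Ck by (simp add: Ck_on_const)

lemma smooth_fun_add:
  assumes "open U" "smooth_fun M U f" "smooth_fun M U g"
  shows "smooth_fun M U (\<lambda>x. f x + g x)"
  unfolding smooth_fun_Ck
proof (intro ballI allI)
  show "Ck_on k (snd c ` (U \<inter> fst c)) (\<lambda>z. f (chart_inv c z) + g (chart_inv c z))" if "c \<in> M" for c k
    by (rule Ck_on_add) (use assms that in \<open>simp_all add: open_chart_image smooth_fun_Ck\<close>)
qed

lemma smooth_fun_mult:
  fixes f g :: "'m \<Rightarrow> 'b::real_normed_algebra"
  assumes "open U" "smooth_fun M U f" "smooth_fun M U g"
  shows "smooth_fun M U (\<lambda>x. f x * g x)"
  unfolding smooth_fun_Ck
proof (intro ballI allI)
  show "Ck_on k (snd c ` (U \<inter> fst c)) (\<lambda>z. f (chart_inv c z) * g (chart_inv c z))" if "c \<in> M" for c k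
    by (rule Ck_on_bilinear[OF bounded_bilinear_mult])
      (use assms that in \<open>simp_all add: open_chart_image smooth_fun_Ck\<close>)
qed

lemma smooth_fun_diff:
  fixes f g :: "'m \<Rightarrow> 'b::real_normed_algebra_1"
  assumes "open U" "smooth_fun M U f" "smooth_fun M U g"
  shows "smooth_fun M U (\<lambda>x. f x - g x)"
proof -
  have "smooth_fun M U (\<lambda>x. (- 1) * g x)"
    by (rule smooth_fun_mult[OF assms(1) smooth_fun_const assms(3)])
  from smooth_fun_add[OF assms(1,2) this] show ?thesis by simp
qed

lemma smooth_fun_divide:
  fixes f g :: "'m \<Rightarrow> complex"
  assumes "open U" "smooth_fun M U f" "smooth_fun M U g" "\<And>x. x \<in> U \<Longrightarrow> g x \<noteq> 0"
  shows "smooth_fun M U (\<lambda>x. f x / g x)"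
proof -
  have "smooth_fun M U (\<lambda>x. inverse (g x))"
    unfolding smooth_fun_Ck
  proof (intro ballI allI)
    show "Ck_on k (snd c ` (U \<inter> fst c)) (\<lambda>z. inverse (g (chart_inv c z)))" if "c \<in> M" for c k
      by (rule Ck_on_inverse) (use assms that in \<open>auto simp: open_chart_image smooth_fun_Ck\<close>)
  qed
  then show ?thesis
    using smooth_fun_mult[OF assms(1,2)] by (simp add: divide_inverse)
qed

lemma smooth_fun_nonzero_nhd:
  fixes f :: "'m \<Rightarrow> complex"
  assumes "open U" "x \<in> U" "smooth_fun M U f" "f x \<noteq> 0"
  obtains V where "open V" "x \<in> V" "V \<subseteq> U" "\<And>y. y \<in> V \<Longrightarrow> f y \<noteq> 0"
proof -
  obtain c where c: "c \<in> M" "x \<in> fst c" using chart_ex by blast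
  have "continuous_on (snd c ` (U \<inter> fst c)) (f \<circ> chart_inv c)"
    using assms(3) c(1) by (intro Cinf_on_continuous) (simp add: smooth_fun_def)
  moreover have "continuous_on (U \<inter> fst c) (snd c)"
    using chart_homeo[OF c(1)] by (auto simp: homeomorphism_def intro: continuous_on_subset)
  ultimately have "continuous_on (U \<inter> fst c) (\<lambda>y. (f \<circ> chart_inv c) (snd c y))"
    by (rule continuous_on_compose2) simp
  then have cont: "continuous_on (U \<inter> fst c) f"
    by (rule continuous_on_eq) (simp add: c)
  have o: "open (U \<inter> fst c)" using assms(1) chart_open[OF c(1)] by blast
  have "open (f -` (- {0}) \<inter> (U \<inter> fst c))"
    using continuous_on_open_vimage[OF o] cont by blast
  then show thesis by (rule that[of "f -` (- {0}) \<inter> (U \<inter> fst c)"]) (use assms c in auto)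
qed


subsection \<open>The differential and its (0,1)-part\<close>

text \<open>The chart that \<^const>\<open>differential\<close> selects depends on the point only, so one chart serves all
  functions and tangent vectors there.\<close>

lemma differential_chart_ex:
  "\<exists>c\<in>M. x \<in> fst c \<and> (\<forall>(f :: 'm \<Rightarrow> complex) X.
     differential M f x X = frechet_derivative (f \<circ> chart_inv c) (at (snd c x)) (X c))"
proof -
  have "(SOME c. c \<in> M \<and> x \<in> fst c) \<in> M \<and> x \<in> fst (SOME c. c \<in> M \<and> x \<in> fst c)"
    by (rule someI_ex) (use chart_ex in blast)
  then show ?thesis unfolding differential_def Let_def by blast
qed

lemma smooth_fun_derivative:
  assumes "smooth_fun M U f" "x \<in> U" "c \<in> M" "x \<in> fst c"
  shows "(f \<circ> chart_inv c has_derivative frechet_derivative (f \<circ> chart_inv c) (at (snd c x)))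
      (at (snd c x))"
  by (rule Cinf_on_frechet[of "snd c ` (U \<inter> fst c)"]) (use assms in \<open>simp_all add: smooth_fun_def\<close>)

text \<open>The chain rule for a change of charts.\<close>

lemma frechet_change_chart:
  assumes "open U" "smooth_fun M U f" "x \<in> U" "c \<in> M" "x \<in> fst c" "c' \<in> M" "x \<in> fst c'"
  shows "frechet_derivative (f \<circ> chart_inv c) (at (snd c x)) u =
    frechet_derivative (f \<circ> chart_inv c') (at (snd c' x))
      (frechet_derivative (snd c' \<circ> chart_inv c) (at (snd c x)) u)"
proof -
  let ?W = "snd c ` ((U \<inter> fst c') \<inter> fst c)"
  have W: "open ?W" using assms by (intro open_chart_image open_Int chart_open) auto
  have x: "snd c x \<in> ?W" using assms by blast
  have "((f \<circ> chart_inv c') \<circ> (snd c' \<circ> chart_inv c) has_derivative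
      frechet_derivative (f \<circ> chart_inv c') (at (snd c' x)) \<circ>
      frechet_derivative (snd c' \<circ> chart_inv c) (at (snd c x))) (at (snd c x))"
    using transition_derivative(1)[OF assms(4,6,5,7)] smooth_fun_derivative[OF assms(2,3,6,7)] assms
    by (intro diff_chain_at) auto
  then have "(f \<circ> chart_inv c has_derivative
      frechet_derivative (f \<circ> chart_inv c') (at (snd c' x)) \<circ>
      frechet_derivative (snd c' \<circ> chart_inv c) (at (snd c x))) (at (snd c x))"
    by (rule has_derivative_transform_within_open[OF _ W x]) (use assms in auto)
  from frechet_derivative_at[OF this] show ?thesis by (metis o_apply)
qed

lemma differential_chart:
  fixes f :: "'m \<Rightarrow> complex"
  assumes "open U" "smooth_fun M U f" "x \<in> U" "c \<in> M" "x \<in> fst c" "X \<in> tangent_space M x"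
  shows "differential M f x X = frechet_derivative (f \<circ> chart_inv c) (at (snd c x)) (X c)"
proof -
  obtain c' where c': "c' \<in> M" "x \<in> fst c'"
    "differential M f x X = frechet_derivative (f \<circ> chart_inv c') (at (snd c' x)) (X c')"
    using differential_chart_ex[of x] by blast
  moreover have "X c' = frechet_derivative (snd c' \<circ> chart_inv c) (at (snd c x)) (X c)"
    using assms c' unfolding tangent_space_def by blast
  ultimately show ?thesis using frechet_change_chart[OF assms(1-5) c'(1,2)] by simp
qed

lemma tangent_J_in:
  assumes "X \<in> tangent_space M x"
  shows "tangent_J X \<in> tangent_space M x"
  unfolding tangent_space_def
proof (intro CollectI conjI ballI allI impI)
  fix c c' assume c: "c \<in> M" "c' \<in> M" "x \<in> fst c" "x \<in> fst c'"
  then have "X c' = frechet_derivative (snd c' \<circ> chart_inv c) (at (snd c x)) (X c)"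
    using assms unfolding tangent_space_def by blast
  then show "\<i> *s X c' = frechet_derivative (snd c' \<circ> chart_inv c) (at (snd c x)) (\<i> *s X c)"
    using transition_derivative(2)[OF c] by metis
next
  fix c assume "\<not> (c \<in> M \<and> x \<in> fst c)"
  then have "X c = 0" using assms unfolding tangent_space_def by blast
  then show "\<i> *s X c = 0" by simp
qed

lemma transition_self:
  assumes "c \<in> M" "x \<in> fst c"
  shows "frechet_derivative (snd c \<circ> chart_inv c) (at (snd c x)) u = u"
proof -
  have "(snd c \<circ> chart_inv c has_derivative (\<lambda>u. u)) (at (snd c x))"
    by (rule has_derivative_transform_within_open[OF has_derivative_ident,
          of "snd c ` (UNIV \<inter> fst c)"])
      (use assms open_chart_image[of c UNIV] in auto)
  from frechet_derivative_at[OF this] show ?thesis by metis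
qed

lemma coord_vec_in_tangent_space:
  assumes "c \<in> M" "x \<in> fst c"
  shows "coord_vec M c u x \<in> tangent_space M x"
  unfolding tangent_space_def
proof (intro CollectI conjI ballI allI impI)
  fix c1 c2 assume A: "c1 \<in> M" "c2 \<in> M" "x \<in> fst c1" "x \<in> fst c2"
  let ?W = "snd c ` ((fst c1 \<inter> fst c2) \<inter> fst c)"
  have W: "open ?W" using A assms by (intro open_chart_image open_Int chart_open) auto
  have x: "snd c x \<in> ?W" using assms A by blast
  have "((snd c2 \<circ> chart_inv c1) \<circ> (snd c1 \<circ> chart_inv c) has_derivative
      frechet_derivative (snd c2 \<circ> chart_inv c1) (at (snd c1 x)) \<circ>
      frechet_derivative (snd c1 \<circ> chart_inv c) (at (snd c x))) (at (snd c x))"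
    using transition_derivative(1) A assms by (intro diff_chain_at) auto
  then have "(snd c2 \<circ> chart_inv c has_derivative
      frechet_derivative (snd c2 \<circ> chart_inv c1) (at (snd c1 x)) \<circ>
      frechet_derivative (snd c1 \<circ> chart_inv c) (at (snd c x))) (at (snd c x))"
    by (rule has_derivative_transform_within_open[OF _ W x]) (use assms A in auto)
  from frechet_derivative_at[OF this]
  show "coord_vec M c u x c2 =
      frechet_derivative (snd c2 \<circ> chart_inv c1) (at (snd c1 x)) (coord_vec M c u x c1)"
    using A by (simp add: coord_vec_def fun_eq_iff)
qed (auto simp: coord_vec_def)

text \<open>The (0,1)-part of \<open>df\<close>, evaluated on real tangent vectors.\<close>

abbreviation dbar :: "('m \<Rightarrow> complex) \<Rightarrow> 'm \<Rightarrow> ('m, 'n) tvec \<Rightarrow> complex" where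
  "dbar f \<equiv> part01 (*) (differential M f)"

lemma dbar_mult:
  assumes "open U" "x \<in> U" "smooth_fun M U f" "smooth_fun M U g"
  shows "dbar (\<lambda>y. f y * g y) x X = f x * dbar g x X + dbar f x X * g x"
proof -
  obtain c where c: "c \<in> M" "x \<in> fst c" "\<And>(f :: 'm \<Rightarrow> complex) X.
     differential M f x X = frechet_derivative (f \<circ> chart_inv c) (at (snd c x)) (X c)"
    using differential_chart_ex[of x] by blast
  have "((\<lambda>y. f y * g y) \<circ> chart_inv c has_derivative
     (\<lambda>v. f x * frechet_derivative (g \<circ> chart_inv c) (at (snd c x)) v +
      frechet_derivative (f \<circ> chart_inv c) (at (snd c x)) v * g x)) (at (snd c x))"
    using has_derivative_mult[OF smooth_fun_derivative[OF assms(3,2) c(1,2)]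
        smooth_fun_derivative[OF assms(4,2) c(1,2)]] c
    by (simp add: o_def)
  from frechet_derivative_at[OF this, symmetric] show ?thesis
    by (simp add: part01_def c(3) algebra_simps)
qed

lemma dbar_diff:
  assumes "open U" "x \<in> U" "smooth_fun M U f" "smooth_fun M U g"
  shows "dbar (\<lambda>y. f y - g y) x X = dbar f x X - dbar g x X"
proof -
  obtain c where c: "c \<in> M" "x \<in> fst c" "\<And>(f :: 'm \<Rightarrow> complex) X.
     differential M f x X = frechet_derivative (f \<circ> chart_inv c) (at (snd c x)) (X c)"
    using differential_chart_ex[of x] by blast
  have "((\<lambda>y. f y - g y) \<circ> chart_inv c has_derivative
     (\<lambda>v. frechet_derivative (f \<circ> chart_inv c) (at (snd c x)) v -
      frechet_derivative (g \<circ> chart_inv c) (at (snd c x)) v)) (at (snd c x))"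
    using has_derivative_diff[OF smooth_fun_derivative[OF assms(3,2) c(1,2)]
        smooth_fun_derivative[OF assms(4,2) c(1,2)]] c
    by (simp add: o_def)
  from frechet_derivative_at[OF this, symmetric] show ?thesis
    by (simp add: part01_def c(3) algebra_simps)
qed

lemma dbar_hol:
  assumes "hol_fun M U f" "x \<in> U"
  shows "dbar f x X = 0"
proof -
  obtain c where c: "c \<in> M" "x \<in> fst c" "\<And>(f :: 'm \<Rightarrow> complex) X.
     differential M f x X = frechet_derivative (f \<circ> chart_inv c) (at (snd c x)) (X c)"
    using differential_chart_ex[of x] by blast
  have "frechet_derivative (f \<circ> chart_inv c) (at (snd c x)) (\<i> *s v) =
      \<i> * frechet_derivative (f \<circ> chart_inv c) (at (snd c x)) v" for v
    using assms c(1,2) by (simp add: hol_fun_def hol_on_def)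
  then show ?thesis by (simp add: part01_def c(3))
qed

lemma hol_fun_if_dbar_zero:
  assumes "open U" "smooth_fun M U f"
    and "\<And>x X. x \<in> U \<Longrightarrow> X \<in> tangent_space M x \<Longrightarrow> dbar f x X = 0"
  shows "hol_fun M U f"
  unfolding hol_fun_def hol_on_def
proof (intro ballI conjI allI)
  fix c assume c: "c \<in> M"
  show "Cinf_on (snd c ` (U \<inter> fst c)) (f \<circ> chart_inv c)"
    using assms(2) c by (simp add: smooth_fun_def)
  fix z v assume "z \<in> snd c ` (U \<inter> fst c)"
  then obtain x where x: "x \<in> U" "x \<in> fst c" "z = snd c x" by blast
  let ?X = "coord_vec M c v x"
  have X: "?X \<in> tangent_space M x" by (rule coord_vec_in_tangent_space[OF c x(2)])
  have Xc: "?X c = v" using transition_self c x by (simp add: coord_vec_def)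
  have "differential M f x ?X + \<i> * differential M f x (tangent_J ?X) = 0"
    using assms(3)[OF x(1) X] by (simp add: part01_def)
  then have "frechet_derivative (f \<circ> chart_inv c) (at z) v +
     \<i> * frechet_derivative (f \<circ> chart_inv c) (at z) (\<i> *s v) = 0"
    using differential_chart[OF assms(1,2) x(1) c x(2)] X tangent_J_in[OF X] Xc x(3) by simp
  \<comment> \<open>Multiplication by \<open>\<i>\<close> turns this into complex linearity.\<close>
  then have "\<i> * (frechet_derivative (f \<circ> chart_inv c) (at z) v +
     \<i> * frechet_derivative (f \<circ> chart_inv c) (at z) (\<i> *s v)) = 0" by simp
  then show "frechet_derivative (f \<circ> chart_inv c) (at z) (\<i> *s v) =
     \<i> * frechet_derivative (f \<circ> chart_inv c) (at z) v"
    by (simp add: algebra_simps)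
qed

lemma differential_zero: "differential M (\<lambda>y. 0::complex) x X = 0"
proof -
  obtain c where c: "differential M (\<lambda>y. 0::complex) x X
      = frechet_derivative ((\<lambda>y. 0) \<circ> chart_inv c) (at (snd c x)) (X c)"
    using differential_chart_ex[of x] by meson
  show ?thesis unfolding c by (simp add: o_def frechet_derivative_const)
qed


subsection \<open>Bump functions\<close>

text \<open>In a chart around \<open>x0\<close>, the bump function is \<open>exp (-1/\<rho>)\<close> with \<open>\<rho> = r\<^sup>2 - |z - z0|\<^sup>2\<close> where
  \<open>\<rho> > 0\<close>, and \<open>0\<close> elsewhere. It vanishes off the image of a closed ball; this is compact,
  hence closed in the Hausdorff manifold, which makes the extension by \<open>0\<close> smooth. It need not be
  constant near \<open>x0\<close>.\<close>

lemma bump_function: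
  assumes "open U" "x0 \<in> U"
  obtains \<beta> :: "'m \<Rightarrow> complex" and K where "smooth_fun M UNIV \<beta>" "\<beta> x0 \<noteq> 0"
    "closed K" "K \<subseteq> U" "\<And>x. x \<notin> K \<Longrightarrow> \<beta> x = 0"
proof -
  obtain c where c: "c \<in> M" "x0 \<in> fst c" using chart_ex by blast
  let ?z0 = "snd c x0"
  have "open (snd c ` (U \<inter> fst c))" "?z0 \<in> snd c ` (U \<inter> fst c)"
    using open_chart_image[OF c(1) assms(1)] assms(2) c by auto
  then obtain r where r: "r > 0" "cball ?z0 r \<subseteq> snd c ` (U \<inter> fst c)"
    using open_contains_cball by blast
  define K where "K = chart_inv c ` cball ?z0 r"
  have "continuous_on (cball ?z0 r) (chart_inv c)"
    using chart_homeo[OF c(1)] r(2) unfolding homeomorphism_def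
    by (meson continuous_on_subset image_mono inf_le2 order_trans)
  then have "compact K" unfolding K_def by (rule compact_continuous_image) simp
  then have K: "closed K" by (rule compact_imp_closed)
  have KU: "K \<subseteq> U \<inter> fst c" unfolding K_def using r(2) c(1) by fastforce
  define \<rho> where "\<rho> x = r\<^sup>2 + (-1) * (\<Sum>k\<in>UNIV. (snd c x $ k - ?z0 $ k) \<bullet> (snd c x $ k - ?z0 $ k))" for x
  have \<rho>: "\<rho> x = r\<^sup>2 - (norm (snd c x - ?z0))\<^sup>2" for x
    unfolding \<rho>_def power2_norm_eq_inner inner_vec_def by simp
  define \<beta> where "\<beta> x = (if x \<in> fst c then complex_of_real (flat 0 (\<rho> x)) else 0)" for x
  have zero: "\<beta> x = 0" if "x \<notin> K" for x
  proof (cases "x \<in> fst c")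
    case True
    have "snd c x \<notin> cball ?z0 r"
    proof
      assume "snd c x \<in> cball ?z0 r"
      then have "chart_inv c (snd c x) \<in> K" unfolding K_def by blast
      then show False using that c True by simp
    qed
    then have "r < norm (snd c x - ?z0)" by (simp add: dist_norm norm_minus_commute)
    then have "r\<^sup>2 < (norm (snd c x - ?z0))\<^sup>2" using r(1) by (simp add: power_strict_mono)
    then have "\<rho> x < 0" by (simp add: \<rho>)
    then show ?thesis by (simp add: \<beta>_def flat_def)
  qed (simp add: \<beta>_def)
  have "smooth_fun M (fst c) \<rho>"
    unfolding smooth_fun_Ck
  proof (intro ballI allI)
    fix c' k assume c': "c' \<in> M"
    let ?W = "snd c' ` (fst c \<inter> fst c')"
    have o: "open ?W" by (intro open_chart_image c' chart_open c)
    have t: "Ck_on k ?W (\<lambda>z. snd c (chart_inv c' z) $ j)" for j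
      using transition_hol[OF c' c(1), of j] by (simp add: hol_on_def Cinf_on_def Int_commute)
    have t: "Ck_on k ?W (\<lambda>z. snd c (chart_inv c' z) $ j - ?z0 $ j)" for j
      using Ck_on_add[OF o t[of j] Ck_on_const[of _ _ "- ?z0 $ j"]] by simp
    have t: "Ck_on k ?W (\<lambda>z. (snd c (chart_inv c' z) $ j - ?z0 $ j) \<bullet> (snd c (chart_inv c' z) $ j - ?z0 $ j))" for j
      by (intro Ck_on_bilinear[OF bounded_bilinear_inner] o t)
    have "Ck_on k ?W (\<lambda>z. \<Sum>j\<in>J. (snd c (chart_inv c' z) $ j - ?z0 $ j) \<bullet> (snd c (chart_inv c' z) $ j - ?z0 $ j))" for J
      by (induction J rule: infinite_finite_induct) (auto intro!: Ck_on_add o t simp: Ck_on_const)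
    then show "Ck_on k ?W (\<lambda>z. \<rho> (chart_inv c' z))"
      unfolding \<rho>_def
      by (intro Ck_on_add o Ck_on_bilinear[OF bounded_bilinear_mult] Ck_on_const)
  qed
  then have "smooth_fun M (fst c) (\<lambda>x. complex_of_real (flat 0 (\<rho> x)))"
    unfolding smooth_fun_Ck
    by (intro ballI allI Ck_on_bounded_linear[OF bounded_linear_of_real] Ck_on_flat open_chart_image
        chart_open c) (auto simp: Cinf_on_def)
  then have "smooth_fun M (fst c) \<beta>"
    by (subst smooth_fun_cong[OF chart_open[OF c(1)]]) (auto simp: \<beta>_def)
  moreover have "smooth_fun M (- K) \<beta>"
    by (subst smooth_fun_cong[where g = "\<lambda>_. 0"]) (use K zero in \<open>auto simp: smooth_fun_const\<close>)
  ultimately have "smooth_fun M (fst c \<union> - K) \<beta>"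
    using K chart_open[OF c(1)] by (intro smooth_fun_Un) auto
  moreover have "fst c \<union> - K = UNIV" using KU by blast
  ultimately have "smooth_fun M UNIV \<beta>" by simp
  moreover have "\<beta> x0 \<noteq> 0" using c r(1) by (simp add: \<beta>_def \<rho> flat_def)
  ultimately show thesis using that K KU zero by blast
qed

end

section \<open>Orthogonal projection in hermitian vector spaces\<close>

context vector_space
begin

lemma independent_nth_sum_zero:
  assumes "distinct vs" "independent (set vs)" "(\<Sum>i<length vs. scale (a i) (vs ! i)) = 0"
    and "i < length vs"
  shows "a i = 0"
proof -
  let ?j = "the_inv_into {..<length vs} ((!) vs)"
  have bij: "bij_betw ((!) vs) {..<length vs} (set vs)"
    by (rule bij_betw_nth[OF assms(1)]) auto
  have j: "?j (vs ! k) = k" if "k < length vs" for k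
    using the_inv_into_f_f[of "(!) vs" "{..<length vs}" k] bij that by (auto simp: bij_betw_def)
  have "(\<Sum>v\<in>set vs. scale (a (?j v)) v) = (\<Sum>k<length vs. scale (a (?j (vs ! k))) (vs ! k))"
    by (rule sum.reindex_bij_betw[OF bij, symmetric])
  also have "\<dots> = 0" using assms(3) j by simp
  finally have "a (?j (vs ! i)) = 0"
    by (rule independentD[OF assms(2) finite_set subset_refl]) (use assms(4) in auto)
  then show ?thesis using j assms(4) by simp
qed

lemma span_eq_if_card_eq:
  assumes "finite T" "independent B" "B \<subseteq> span T" "card B = card T"
  shows "span B = span T"
proof -
  have fB: "finite B" using independent_span_bound[OF assms(1-3)] by blast
  have "T \<subseteq> span B"
  proof
    fix v assume v: "v \<in> T"
    show "v \<in> span B"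
    proof (rule ccontr)
      assume nv: "v \<notin> span B"
      then have "independent (insert v B)" using assms(2) by (rule independent_insertI)
      moreover have "insert v B \<subseteq> span T" using assms(3) v span_base by blast
      ultimately have "card (insert v B) \<le> card T" using independent_span_bound[OF assms(1)] by blast
      moreover have "v \<notin> B" using nv span_base by blast
      ultimately show False using fB assms(4) by simp
    qed
  qed
  then show ?thesis using assms(3) by (simp add: span_eq)
qed

end

text \<open>The projection of \<open>v\<close> onto the span of a list of mutually orthogonal nonzero vectors.\<close>

definition proj_on ::
    "(complex \<Rightarrow> 'v::ab_group_add \<Rightarrow> 'v) \<Rightarrow> ('v \<Rightarrow> 'v \<Rightarrow> complex) \<Rightarrow> 'v list \<Rightarrow> 'v \<Rightarrow> 'v" where
  "proj_on sc H gs v = (\<Sum>g\<leftarrow>gs. sc (H v g / H g g) g)"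

text \<open>Mutually orthogonal nonzero vectors of the space \<open>V\<close>.\<close>

primrec orthogonal_list ::
    "'v::zero set \<Rightarrow> ('v \<Rightarrow> 'v \<Rightarrow> complex) \<Rightarrow> 'v list \<Rightarrow> bool" where
  "orthogonal_list V H [] \<longleftrightarrow> True"
| "orthogonal_list V H (g # gs) \<longleftrightarrow>
     g \<in> V \<and> g \<noteq> 0 \<and> (\<forall>g'\<in>set gs. H g g' = 0) \<and> orthogonal_list V H gs"

lemma orthogonal_list_subset: "orthogonal_list V H gs \<Longrightarrow> set gs \<subseteq> V"
  by (induction gs) auto

text \<open>A subspace \<open>V\<close> of a complex vector space with a hermitian inner product \<open>H\<close>, which is linear in
  the first argument and constrained on \<open>V\<close> only.\<close>

locale herm_space = vector_space sc
  for sc :: "complex \<Rightarrow> 'v::ab_group_add \<Rightarrow> 'v" +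
  fixes V :: "'v set" and H :: "'v \<Rightarrow> 'v \<Rightarrow> complex"
  assumes subspace_V: "subspace V"
    and H_cnj: "v \<in> V \<Longrightarrow> w \<in> V \<Longrightarrow> H w v = cnj (H v w)"
    and H_pos: "v \<in> V \<Longrightarrow> v \<noteq> 0 \<Longrightarrow> 0 < Re (H v v)"
    and H_lin: "v \<in> V \<Longrightarrow> w \<in> V \<Longrightarrow> t \<in> V \<Longrightarrow> H (sc a v + sc b w) t = a * H v t + b * H w t"
begin

lemma H_add: "v \<in> V \<Longrightarrow> w \<in> V \<Longrightarrow> t \<in> V \<Longrightarrow> H (v + w) t = H v t + H w t"
  using H_lin[of v w t 1 1] by simp

lemma H_scale: "v \<in> V \<Longrightarrow> t \<in> V \<Longrightarrow> H (sc a v) t = a * H v t"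
  using H_lin[of v v t a 0] by simp

lemma H_zero: "t \<in> V \<Longrightarrow> H 0 t = 0"
  using H_scale[of 0 t 0] subspace_0[OF subspace_V] by simp

lemma H_diff: "v \<in> V \<Longrightarrow> w \<in> V \<Longrightarrow> t \<in> V \<Longrightarrow> H (v - w) t = H v t - H w t"
  using H_lin[of v w t 1 "-1"] by simp

lemma H_scale_right: "v \<in> V \<Longrightarrow> t \<in> V \<Longrightarrow> H t (sc a v) = cnj a * H t v"
  using H_cnj[of "sc a v" t] H_cnj[of v t] H_scale[of v t a] subspace_scale[OF subspace_V] by simp

lemma H_add_right: "v \<in> V \<Longrightarrow> w \<in> V \<Longrightarrow> t \<in> V \<Longrightarrow> H t (v + w) = H t v + H t w"
  using H_cnj[of "v + w" t] H_cnj[of v t] H_cnj[of w t] H_add[of v w t] subspace_add[OF subspace_V]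
  by simp

lemma H_orth_sym: "v \<in> V \<Longrightarrow> w \<in> V \<Longrightarrow> H v w = 0 \<Longrightarrow> H w v = 0"
  using H_cnj[of v w] by simp

lemma H_self_zero: "v \<in> V \<Longrightarrow> H v v = 0 \<Longrightarrow> v = 0"
  using H_pos[of v] by auto

lemma span_subset_V: "B \<subseteq> V \<Longrightarrow> span B \<subseteq> V"
  by (rule span_minimal[OF _ subspace_V])

lemma orth_span_left:
  assumes "u \<in> V" "B \<subseteq> V" "\<And>b. b \<in> B \<Longrightarrow> H b u = 0" "w \<in> span B"
  shows "H w u = 0"
proof -
  have "w \<in> V \<and> H w u = 0"
    using assms(4)
  proof (induction rule: span_induct_alt)
    case base
    then show ?case using assms(1) H_zero subspace_0[OF subspace_V] by blast
  next
    case (step c x y)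
    then have "x \<in> V" using assms(2) by blast
    then show ?case using step assms(1,3) H_add H_scale subspace_add[OF subspace_V]
        subspace_scale[OF subspace_V] by simp
  qed
  then show ?thesis by blast
qed

lemma orth_span_right:
  assumes "u \<in> V" "B \<subseteq> V" "\<And>b. b \<in> B \<Longrightarrow> H u b = 0" "w \<in> span B"
  shows "H u w = 0"
proof -
  have "H w u = 0"
    by (rule orth_span_left[OF assms(1,2) _ assms(4)]) (use assms H_orth_sym in blast)
  then show ?thesis using H_orth_sym assms(1,4) span_subset_V[OF assms(2)] by blast
qed

lemma proj_on_in_span: "proj_on sc H gs v \<in> span (set gs)"
proof (induction gs)
  case Nil
  then show ?case by (simp add: proj_on_def span_zero)
next
  case (Cons g gs)
  have "proj_on sc H gs v \<in> span (set (g # gs))"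
    using Cons span_mono[of "set gs" "set (g # gs)"] by auto
  then show ?case by (auto simp: proj_on_def intro!: span_add span_scale intro: span_base)
qed

lemma proj_on_in_V: "orthogonal_list V H gs \<Longrightarrow> proj_on sc H gs v \<in> V"
  using proj_on_in_span span_subset_V orthogonal_list_subset by blast

lemma H_proj_on:
  assumes "orthogonal_list V H gs" "u \<in> set gs"
  shows "H (proj_on sc H gs v) u = H v u"
  using assms
proof (induction gs)
  case (Cons g gs)
  have V: "g \<in> V" "set gs \<subseteq> V" "u \<in> V" "sc a g \<in> V" "proj_on sc H gs v \<in> V" for a
    using Cons.prems orthogonal_list_subset[of V H] proj_on_in_V subspace_scale[OF subspace_V]
    by fastforce+
  have *: "H (proj_on sc H (g # gs) v) u = H v g / H g g * H g u + H (proj_on sc H gs v) u"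
    using V by (simp add: proj_on_def H_add H_scale)
  show ?case
  proof (cases "u = g")
    case True
    have "H (proj_on sc H gs v) g = 0"
      by (rule orth_span_left[OF V(1,2) _ proj_on_in_span])
        (use Cons.prems V in \<open>auto intro: H_orth_sym[of g]\<close>)
    moreover have "H g g \<noteq> 0" using H_self_zero V(1) Cons.prems(1) by auto
    ultimately show ?thesis using * True by simp
  next
    case False
    then show ?thesis using * Cons by auto
  qed
qed simp

lemma proj_on_residual_orth:
  assumes "orthogonal_list V H gs" "v \<in> V" "w \<in> span (set gs)"
  shows "H (v - proj_on sc H gs v) w = 0"
proof (rule orth_span_right[OF _ _ _ assms(3)])
  show "v - proj_on sc H gs v \<in> V"
    using assms proj_on_in_V subspace_diff[OF subspace_V] by blast
  show "set gs \<subseteq> V" using assms(1) by (rule orthogonal_list_subset)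
  show "H (v - proj_on sc H gs v) b = 0" if "b \<in> set gs" for b
    using H_diff[of v "proj_on sc H gs v" b] H_proj_on[OF assms(1) that] assms proj_on_in_V
      orthogonal_list_subset that by fastforce
qed

lemma proj_on_id:
  assumes "orthogonal_list V H gs" "v \<in> span (set gs)"
  shows "proj_on sc H gs v = v"
proof -
  have v: "v \<in> V" using assms span_subset_V orthogonal_list_subset by blast
  have "v - proj_on sc H gs v \<in> span (set gs)"
    using assms proj_on_in_span span_diff by blast
  then have "H (v - proj_on sc H gs v) (v - proj_on sc H gs v) = 0"
    by (rule proj_on_residual_orth[OF assms(1) v])
  then have "v - proj_on sc H gs v = 0"
    using H_self_zero v proj_on_in_V[OF assms(1)] subspace_diff[OF subspace_V] by blast
  then show ?thesis by simp
qed

lemma span_Gram_Schmidt_step: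
  assumes "span (set gs) = span B"
  shows "span (insert (s - proj_on sc H gs s) (set gs)) = span (insert s B)"
proof -
  let ?g = "s - proj_on sc H gs s"
  have sub: "set gs \<subseteq> span (insert s B)" "B \<subseteq> span (insert ?g (set gs))"
    using assms span_base span_mono[of B "insert s B"] span_mono[of "set gs" "insert ?g (set gs)"]
    by blast+
  have p: "proj_on sc H gs s \<in> span (insert s B)" "proj_on sc H gs s \<in> span (insert ?g (set gs))"
    using proj_on_in_span[of gs s] assms span_mono[of B "insert s B"]
      span_mono[of "set gs" "insert ?g (set gs)"] by blast+
  have "?g \<in> span (insert s B)" by (intro span_diff p span_base) simp
  moreover have "s \<in> span (insert ?g (set gs))"
    using span_add[OF span_base[of ?g "insert ?g (set gs)"] p(2)] by simp
  ultimately show ?thesis using sub by (simp add: span_eq)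
qed

text \<open>If \<open>V\<close> is spanned by an orthogonal list, every conjugate-linear functional on \<open>V\<close> is the inner
  product with a fixed vector.\<close>

lemma functional_representation:
  assumes "orthogonal_list V H gs" "span (set gs) = V"
    and "\<And>v w. v \<in> V \<Longrightarrow> w \<in> V \<Longrightarrow> f (v + w) = f v + f w"
    and "\<And>a v. v \<in> V \<Longrightarrow> f (sc a v) = cnj a * f v"
  obtains z where "z \<in> V" "\<And>v. v \<in> V \<Longrightarrow> H z v = f v"
proof -
  have "\<exists>z\<in>span (set gs). \<forall>g\<in>set gs. H z g = f g"
    using assms(1)
  proof (induction gs)
    case Nil
    then show ?case using span_zero by auto
  next
    case (Cons g gs)
    then obtain z where z: "z \<in> span (set gs)" "\<forall>g\<in>set gs. H z g = f g" by auto
    have V: "g \<in> V" "set gs \<subseteq> V" "z \<in> V" "sc a g \<in> V" for a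
      using Cons.prems orthogonal_list_subset[of V H gs] z span_subset_V[of "set gs"]
        subspace_scale[OF subspace_V] by auto
    have "H z g = 0"
      by (rule orth_span_left[OF V(1,2) _ z(1)]) (use Cons.prems V in \<open>auto intro: H_orth_sym[of g]\<close>)
    moreover have "H g g \<noteq> 0" using H_self_zero V(1) Cons.prems by auto
    ultimately have "H (sc (f g / H g g) g + z) u = f u" if "u \<in> set (g # gs)" for u
      using that z V Cons.prems by (cases "u = g") (auto simp: H_add H_scale subset_iff)
    moreover have "sc (f g / H g g) g + z \<in> span (set (g # gs))"
      using z(1) span_mono[of "set gs" "set (g # gs)"] by (auto intro!: span_add span_scale intro: span_base)
    ultimately show ?case by blast
  qed
  then obtain z where z: "z \<in> V" "\<And>g. g \<in> set gs \<Longrightarrow> H z g = f g" using assms(2) by blast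
  have "H z v = f v" if "v \<in> V" for v
  proof -
    have "v \<in> span (set gs)" using that assms(2) by simp
    then have "v \<in> V \<and> H z v = f v"
    proof (induction rule: span_induct_alt)
      case base
      have "f 0 = 0" using assms(4)[of 0 0] subspace_0[OF subspace_V] by simp
      moreover have "H z 0 = 0" using H_scale_right[of 0 z 0] z subspace_0[OF subspace_V] by simp
      ultimately show ?case using subspace_0[OF subspace_V] by simp
    next
      case (step c x y)
      then have "x \<in> V" "sc c x \<in> V"
        using orthogonal_list_subset[OF assms(1)] subspace_scale[OF subspace_V] by auto
      then show ?case
        using step z assms(3)[of "sc c x" y] assms(4)[of x c] H_add_right H_scale_right
          subspace_add[OF subspace_V] by simp
    qed
    then show ?thesis by blast
  qed
  with z(1) show thesis using that by blast
qed

end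

section \<open>Sections of a hermitian holomorphic vector bundle\<close>

text \<open>A holomorphic vector bundle with a hermitian metric. Each of its fibres is a hermitian vector
  space.\<close>

locale hermitian_bundle = complex_mfd M
  for M :: "('m::{t2_space,second_countable_topology}, 'n::finite) chart set" +
  fixes E :: "('m, 'v::ab_group_add) vbundle" and h :: "'m \<Rightarrow> 'v \<Rightarrow> 'v \<Rightarrow> complex"
  assumes vbundle: "holomorphic_vector_bundle M E" and metric: "hermitian_metric M E h"
begin

sublocale fib: herm_space "scl E" "fibre E x" "h x" for x
proof -
  have "vector_space (scl E)" using vbundle by (simp add: holomorphic_vector_bundle_def)
  then interpret vector_space "scl E" .
  show "herm_space (scl E) (fibre E x) (h x)"
  proof
    show "subspace (fibre E x)" using vbundle by (simp add: holomorphic_vector_bundle_def)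
    show "h x w v = cnj (h x v w)" if "v \<in> fibre E x" "w \<in> fibre E x" for v w
      using metric that unfolding hermitian_metric_def by blast
    show "0 < Re (h x v v)" if "v \<in> fibre E x" "v \<noteq> 0" for v
      using metric that unfolding hermitian_metric_def by blast
    show "h x (scl E a v + scl E b w) t = a * h x v t + b * h x w t"
      if "v \<in> fibre E x" "w \<in> fibre E x" "t \<in> fibre E x" for v w t a b
      using metric that unfolding hermitian_metric_def by blast
  qed
qed

lemma frame_nhd: "\<exists>(W, es)\<in>frames E. x \<in> W"
  using vbundle unfolding holomorphic_vector_bundle_def by blast

lemma frame_open: "(W, es) \<in> frames E \<Longrightarrow> open W"
  using vbundle unfolding holomorphic_vector_bundle_def by blast

lemma frame_frame_on: "(W, es) \<in> frames E \<Longrightarrow> frame_on E (fibre E) W es"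
  using vbundle unfolding holomorphic_vector_bundle_def by blast

lemma frame_hol: "(W, es) \<in> frames E \<Longrightarrow> e \<in> set es \<Longrightarrow> hol_section M E W e"
  using vbundle unfolding holomorphic_vector_bundle_def by blast

lemma smooth_metric:
  "open U \<Longrightarrow> smooth_section M E U s \<Longrightarrow> smooth_section M E U t \<Longrightarrow>
    smooth_fun M U (\<lambda>x. h x (s x) (t x))"
  using metric unfolding hermitian_metric_def by blast

lemma smooth_sectionI:
  assumes "\<And>x. x \<in> U \<Longrightarrow> s x \<in> fibre E x"
    and "\<And>W es. (W, es) \<in> frames E \<Longrightarrow> \<exists>f. (\<forall>i<length es. smooth_fun M (U \<inter> W) (f i)) \<and>
        (\<forall>x\<in>U \<inter> W. s x = lin_comb E es f x)"
  shows "smooth_section M E U s"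
  using assms unfolding smooth_section_def by blast

lemma smooth_section_fibre: "smooth_section M E U s \<Longrightarrow> x \<in> U \<Longrightarrow> s x \<in> fibre E x"
  unfolding smooth_section_def by blast

lemma smooth_section_coeffs:
  assumes "smooth_section M E U s" "(W, es) \<in> frames E"
  obtains f where "\<And>i. i < length es \<Longrightarrow> smooth_fun M (U \<inter> W) (f i)"
    "\<And>x. x \<in> U \<inter> W \<Longrightarrow> s x = lin_comb E es f x"
proof -
  have "\<exists>f. (\<forall>i<length es. smooth_fun M (U \<inter> W) (f i)) \<and> (\<forall>x\<in>U \<inter> W. s x = lin_comb E es f x)"
    using assms unfolding smooth_section_def by blast
  then show thesis using that by blast
qed

lemma hol_section_coeffs:
  assumes "hol_section M E U s" "(W, es) \<in> frames E"
  obtains f where "\<And>i. i < length es \<Longrightarrow> hol_fun M (U \<inter> W) (f i)"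
    "\<And>x. x \<in> U \<inter> W \<Longrightarrow> s x = lin_comb E es f x"
proof -
  have "\<exists>f. (\<forall>i<length es. hol_fun M (U \<inter> W) (f i)) \<and> (\<forall>x\<in>U \<inter> W. s x = lin_comb E es f x)"
    using assms unfolding hol_section_def by blast
  then show thesis using that by blast
qed

lemma hol_sectionI:
  assumes "\<And>x. x \<in> U \<Longrightarrow> s x \<in> fibre E x"
    and "\<And>W es. (W, es) \<in> frames E \<Longrightarrow> \<exists>f. (\<forall>i<length es. hol_fun M (U \<inter> W) (f i)) \<and>
        (\<forall>x\<in>U \<inter> W. s x = lin_comb E es f x)"
  shows "hol_section M E U s"
  using assms unfolding hol_section_def by blast

lemma hol_section_fibre: "hol_section M E U s \<Longrightarrow> x \<in> U \<Longrightarrow> s x \<in> fibre E x"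
  unfolding hol_section_def by blast

lemma hol_section_smooth:
  assumes "hol_section M E U s"
  shows "smooth_section M E U s"
proof (rule smooth_sectionI)
  show "s x \<in> fibre E x" if "x \<in> U" for x using assms that by (rule hol_section_fibre)
  fix W es assume "(W, es) \<in> frames E"
  from hol_section_coeffs[OF assms this] show "\<exists>f. (\<forall>i<length es. smooth_fun M (U \<inter> W) (f i)) \<and>
        (\<forall>x\<in>U \<inter> W. s x = lin_comb E es f x)"
    using hol_fun_smooth by metis
qed

lemma smooth_section_subset:
  assumes "smooth_section M E U s" "V \<subseteq> U"
  shows "smooth_section M E V s"
proof (rule smooth_sectionI)
  show "s x \<in> fibre E x" if "x \<in> V" for x using assms that smooth_section_fibre by blast
  fix W es assume "(W, es) \<in> frames E"
  from smooth_section_coeffs[OF assms(1) this] obtain f where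
    "\<And>i. i < length es \<Longrightarrow> smooth_fun M (U \<inter> W) (f i)"
    "\<And>x. x \<in> U \<inter> W \<Longrightarrow> s x = lin_comb E es f x" by blast
  then show "\<exists>f. (\<forall>i<length es. smooth_fun M (V \<inter> W) (f i)) \<and>
        (\<forall>x\<in>V \<inter> W. s x = lin_comb E es f x)"
    using assms(2) by (intro exI[of _ f]) (auto intro: smooth_fun_subset)
qed

lemma hol_section_subset:
  assumes "hol_section M E U s" "V \<subseteq> U"
  shows "hol_section M E V s"
proof (rule hol_sectionI)
  show "s x \<in> fibre E x" if "x \<in> V" for x using assms that hol_section_fibre by blast
  fix W es assume "(W, es) \<in> frames E"
  from hol_section_coeffs[OF assms(1) this] obtain f where
    "\<And>i. i < length es \<Longrightarrow> hol_fun M (U \<inter> W) (f i)"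
    "\<And>x. x \<in> U \<inter> W \<Longrightarrow> s x = lin_comb E es f x" by blast
  then show "\<exists>f. (\<forall>i<length es. hol_fun M (V \<inter> W) (f i)) \<and>
        (\<forall>x\<in>V \<inter> W. s x = lin_comb E es f x)"
    using assms(2) by (intro exI[of _ f]) (auto intro: hol_fun_subset)
qed

lemma scl_lin_comb: "scl E a (lin_comb E es f x) = lin_comb E es (\<lambda>i y. a * f i y) x"
  by (simp add: lin_comb_def fib.scale_sum_right)

lemma lin_comb_diff:
  "lin_comb E es f x - lin_comb E es g x = lin_comb E es (\<lambda>i y. f i y - g i y) x"
  by (simp add: lin_comb_def fib.scale_left_diff_distrib sum_subtractf)

lemma lin_comb_add:
  "lin_comb E es f x + lin_comb E es g x = lin_comb E es (\<lambda>i y. f i y + g i y) x"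
  by (simp add: lin_comb_def fib.scale_left_distrib sum.distrib)

lemma smooth_section_scl:
  assumes "open U" "smooth_fun M U f" "smooth_section M E U s"
  shows "smooth_section M E U (\<lambda>x. scl E (f x) (s x))"
proof (rule smooth_sectionI)
  show "scl E (f x) (s x) \<in> fibre E x" if "x \<in> U" for x
    using smooth_section_fibre[OF assms(3) that] fib.subspace_scale[OF fib.subspace_V] by blast
  fix W es assume W: "(W, es) \<in> frames E"
  from smooth_section_coeffs[OF assms(3) this] obtain k where
    k: "\<And>i. i < length es \<Longrightarrow> smooth_fun M (U \<inter> W) (k i)"
    "\<And>x. x \<in> U \<inter> W \<Longrightarrow> s x = lin_comb E es k x" by blast
  have o: "open (U \<inter> W)" using frame_open[OF W] assms(1) by blast
  have "smooth_fun M (U \<inter> W) (\<lambda>x. f x * k i x)" if "i < length es" for i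
    by (rule smooth_fun_mult[OF o smooth_fun_subset[OF assms(2)] k(1)[OF that]]) simp
  moreover have "scl E (f x) (s x) = lin_comb E es (\<lambda>i y. f y * k i y) x" if "x \<in> U \<inter> W" for x
    unfolding k(2)[OF that] scl_lin_comb by (simp add: lin_comb_def)
  ultimately show "\<exists>k. (\<forall>i<length es. smooth_fun M (U \<inter> W) (k i)) \<and>
        (\<forall>x\<in>U \<inter> W. scl E (f x) (s x) = lin_comb E es k x)"
    by (intro exI[of _ "\<lambda>i x. f x * k i x"]) blast
qed

lemma smooth_section_zero: "smooth_section M E U (\<lambda>x. 0)"
proof (rule smooth_sectionI)
  show "0 \<in> fibre E x" for x by (rule fib.subspace_0[OF fib.subspace_V])
  fix W es assume "(W, es) \<in> frames E"
  show "\<exists>f. (\<forall>i<length es. smooth_fun M (U \<inter> W) (f i)) \<and> (\<forall>x\<in>U \<inter> W. 0 = lin_comb E es f x)"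
    by (intro exI[of _ "\<lambda>i x. 0"]) (simp add: lin_comb_def smooth_fun_const)
qed

lemma smooth_section_add:
  assumes "open U" "smooth_section M E U s" "smooth_section M E U t"
  shows "smooth_section M E U (\<lambda>x. s x + t x)"
proof (rule smooth_sectionI)
  show "s x + t x \<in> fibre E x" if "x \<in> U" for x
    using smooth_section_fibre[OF assms(2) that] smooth_section_fibre[OF assms(3) that]
      fib.subspace_add[OF fib.subspace_V] by blast
  fix W es assume W: "(W, es) \<in> frames E"
  from smooth_section_coeffs[OF assms(2) this] obtain k where
    k: "\<And>i. i < length es \<Longrightarrow> smooth_fun M (U \<inter> W) (k i)"
    "\<And>x. x \<in> U \<inter> W \<Longrightarrow> s x = lin_comb E es k x" by blast
  from smooth_section_coeffs[OF assms(3) W] obtain l where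
    l: "\<And>i. i < length es \<Longrightarrow> smooth_fun M (U \<inter> W) (l i)"
    "\<And>x. x \<in> U \<inter> W \<Longrightarrow> t x = lin_comb E es l x" by blast
  have o: "open (U \<inter> W)" using frame_open[OF W] assms(1) by blast
  show "\<exists>k. (\<forall>i<length es. smooth_fun M (U \<inter> W) (k i)) \<and>
        (\<forall>x\<in>U \<inter> W. s x + t x = lin_comb E es k x)"
    by (intro exI[of _ "\<lambda>i x. k i x + l i x"] conjI allI impI ballI smooth_fun_add o k l)
      (simp_all add: k l lin_comb_add)
qed

lemma smooth_section_diff:
  assumes "open U" "smooth_section M E U s" "smooth_section M E U t"
  shows "smooth_section M E U (\<lambda>x. s x - t x)"
  using smooth_section_add[OF assms(1,2)
      smooth_section_scl[OF assms(1) smooth_fun_const[of _ "-1"] assms(3)]]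
  by simp

subsection \<open>Gram-Schmidt process for sections\<close>

text \<open>The values at a point of a list of sections.\<close>

abbreviation vals :: "('m \<Rightarrow> 'v) list \<Rightarrow> 'm \<Rightarrow> 'v list" where
  "vals gs x \<equiv> map (\<lambda>g. g x) gs"

text \<open>The pointwise projection of \<open>s\<close> onto the span of the sections in \<open>gs\<close>, which are meant to be
  orthogonal.\<close>

abbreviation proj_sec :: "('m \<Rightarrow> 'v) list \<Rightarrow> ('m \<Rightarrow> 'v) \<Rightarrow> 'm \<Rightarrow> 'v" where
  "proj_sec gs s x \<equiv> proj_on (scl E) (h x) (vals gs x) (s x)"

lemma smooth_section_proj:
  assumes "open U" "smooth_section M E U s" "\<And>g. g \<in> set gs \<Longrightarrow> smooth_section M E U g"
    and "\<And>x. x \<in> U \<Longrightarrow> orthogonal_list (fibre E x) (h x) (vals gs x)"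
  shows "smooth_section M E U (proj_sec gs s)"
  using assms(3,4)
proof (induction gs)
  case Nil
  then show ?case by (simp add: proj_on_def smooth_section_zero)
next
  case (Cons g gs)
  have g: "smooth_section M E U g" using Cons.prems(1) by simp
  have nz: "h x (g x) (g x) \<noteq> 0" if "x \<in> U" for x
    using Cons.prems(2)[OF that] fib.H_self_zero[of "g x" x] by auto
  have "smooth_section M E U (\<lambda>x. scl E (h x (s x) (g x) / h x (g x) (g x)) (g x))"
    by (intro smooth_section_scl smooth_fun_divide smooth_metric assms(1,2) g nz)
  moreover have "smooth_section M E U (proj_sec gs s)"
    by (rule Cons.IH) (use Cons.prems in auto)
  ultimately show ?case
    using smooth_section_add[OF assms(1)] by (simp add: proj_on_def)
qed

text \<open>The Gram-Schmidt process for sections that are linearly independent at one point. It also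
  shows that they stay linearly independent nearby, because the vectors that it produces stay
  nonzero.\<close>

lemma local_Gram_Schmidt:
  assumes "open U" "x0 \<in> U" "\<And>s. s \<in> set ss \<Longrightarrow> smooth_section M E U s"
    and "distinct (vals ss x0)" "\<not> fib.dependent (set (vals ss x0))"
  shows "\<exists>V gs. open V \<and> x0 \<in> V \<and> V \<subseteq> U \<and> (\<forall>g\<in>set gs. smooth_section M E V g) \<and>
    (\<forall>x\<in>V. orthogonal_list (fibre E x) (h x) (vals gs x) \<and>
       fib.span (set (vals gs x)) = fib.span (set (vals ss x)) \<and>
       distinct (vals ss x) \<and> \<not> fib.dependent (set (vals ss x)))"
  using assms(3-5)
proof (induction ss)
  case Nil
  then show ?case using assms(1,2) by (intro exI[of _ U] exI[of _ "[]"]) (auto simp: fib.dependent_def)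
next
  case (Cons s ss)
  have s: "smooth_section M E U s" using Cons.prems by simp
  have sx0: "s x0 \<notin> fib.span (set (vals ss x0))"
    using Cons.prems(2,3) fib.independent_insert[of "s x0" "set (vals ss x0)"] by auto
  have "\<not> fib.dependent (set (vals ss x0))"
    by (rule fib.independent_mono[OF Cons.prems(3)]) auto
  then have "\<exists>V gs. open V \<and> x0 \<in> V \<and> V \<subseteq> U \<and> (\<forall>g\<in>set gs. smooth_section M E V g) \<and>
    (\<forall>x\<in>V. orthogonal_list (fibre E x) (h x) (vals gs x) \<and>
       fib.span (set (vals gs x)) = fib.span (set (vals ss x)) \<and>
       distinct (vals ss x) \<and> \<not> fib.dependent (set (vals ss x)))"
    by (intro Cons.IH) (use Cons.prems(1,2) in simp_all)
  then obtain V gs where V: "open V" "x0 \<in> V" "V \<subseteq> U" "\<forall>g\<in>set gs. smooth_section M E V g"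
    and gs0: "\<forall>x\<in>V. orthogonal_list (fibre E x) (h x) (vals gs x) \<and>
       fib.span (set (vals gs x)) = fib.span (set (vals ss x)) \<and>
       distinct (vals ss x) \<and> \<not> fib.dependent (set (vals ss x))"
    by (elim exE conjE)
  have gs: "orthogonal_list (fibre E x) (h x) (vals gs x)"
      "fib.span (set (vals gs x)) = fib.span (set (vals ss x))"
      "distinct (vals ss x) \<and> \<not> fib.dependent (set (vals ss x))" if "x \<in> V" for x
    using gs0 that by simp_all
  define g where "g x = s x - proj_sec gs s x" for x
  have sV: "smooth_section M E V s" using s V(3) by (rule smooth_section_subset)
  have gV: "smooth_section M E V g"
    unfolding g_def by (intro smooth_section_diff V smooth_section_proj sV) (use V(4) gs in auto)
  have "g x0 \<noteq> 0"
    using fib.proj_on_in_span[of x0 "vals gs x0" "s x0"] sx0 gs(2)[OF V(2)] by (auto simp: g_def)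
  then have "h x0 (g x0) (g x0) \<noteq> 0"
    using fib.H_self_zero smooth_section_fibre[OF gV V(2)] by blast
  then obtain V' where V': "open V'" "x0 \<in> V'" "V' \<subseteq> V" "\<And>x. x \<in> V' \<Longrightarrow> h x (g x) (g x) \<noteq> 0"
    using smooth_fun_nonzero_nhd[OF V(1,2) smooth_metric[OF V(1) gV gV]] by blast
  have pt: "orthogonal_list (fibre E x) (h x) (vals (g # gs) x) \<and>
       fib.span (set (vals (g # gs) x)) = fib.span (set (vals (s # ss) x)) \<and>
       distinct (vals (s # ss) x) \<and> \<not> fib.dependent (set (vals (s # ss) x))" if x: "x \<in> V'" for x
  proof -
    have xV: "x \<in> V" using x V'(3) by blast
    have gE: "g x \<in> fibre E x" using smooth_section_fibre[OF gV xV] .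
    have g0: "g x \<noteq> 0" using V'(4)[OF x] fib.H_zero[OF gE] by auto
    have "h x (g x) w = 0" if "w \<in> set (vals gs x)" for w
      unfolding g_def
      by (rule fib.proj_on_residual_orth[OF gs(1)[OF xV] smooth_section_fibre[OF sV xV]
            fib.span_base[OF that]])
    then have 1: "orthogonal_list (fibre E x) (h x) (vals (g # gs) x)"
      using gE g0 gs(1)[OF xV] by simp
    have 2: "fib.span (set (vals (g # gs) x)) = fib.span (set (vals (s # ss) x))"
      using fib.span_Gram_Schmidt_step[OF gs(2)[OF xV], where x = x and s = "s x"] by (simp add: g_def)
    have 3: "s x \<notin> fib.span (set (vals ss x))"
    proof
      assume "s x \<in> fib.span (set (vals ss x))"
      then have "s x \<in> fib.span (set (vals gs x))" using gs(2)[OF xV] by simp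
      from fib.proj_on_id[OF gs(1)[OF xV] this] g0 show False by (simp add: g_def)
    qed
    then have "s x \<notin> set (vals ss x)" using fib.span_base by blast
    moreover have "\<not> fib.dependent (insert (s x) (set (vals ss x)))"
      by (rule fib.independent_insertI[OF 3]) (use gs(3)[OF xV] in blast)
    ultimately show ?thesis using 1 2 gs(3)[OF xV] by simp
  qed
  have "smooth_section M E V' g'" if "g' \<in> set (g # gs)" for g'
  proof (rule smooth_section_subset[OF _ V'(3)])
    show "smooth_section M E V g'" using that bspec[OF V(4), of g'] gV by (cases "g' = g") simp_all
  qed
  then have "\<forall>g'\<in>set (g # gs). smooth_section M E V' g'" by (rule ballI)
  moreover have "V' \<subseteq> U" using V'(3) V(3) by blast
  moreover note V'(1,2) ballI[of V', OF pt]
  ultimately show ?case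
    by (intro exI[of _ V'] exI[of _ "g # gs"] conjI) assumption+
qed

subsection \<open>Cut-off and global extension\<close>

lemma smooth_fun_cutoff:
  fixes \<beta> f :: "'m \<Rightarrow> complex"
  assumes "open U" "open W" "smooth_fun M UNIV \<beta>" "closed K" "K \<subseteq> U" "\<And>x. x \<notin> K \<Longrightarrow> \<beta> x = 0"
    and "smooth_fun M (U \<inter> W) f"
  shows "smooth_fun M W (\<lambda>x. \<beta> x * f x)"
proof -
  have "smooth_fun M (U \<inter> W) (\<lambda>x. \<beta> x * f x)"
    by (rule smooth_fun_mult[OF _ smooth_fun_subset[OF assms(3)] assms(7)]) (use assms in auto)
  moreover have "smooth_fun M (W - K) (\<lambda>x. \<beta> x * f x)"
    by (subst smooth_fun_cong[where g = "\<lambda>_. 0"])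
      (use assms in \<open>auto simp: smooth_fun_const intro: open_Diff\<close>)
  ultimately have "smooth_fun M (U \<inter> W \<union> (W - K)) (\<lambda>x. \<beta> x * f x)"
    using assms by (intro smooth_fun_Un) (auto intro: open_Diff)
  moreover have "U \<inter> W \<union> (W - K) = W" using assms(5) by blast
  ultimately show ?thesis by simp
qed

lemma smooth_section_cutoff:
  assumes "open U" "smooth_section M E U s"
    and "smooth_fun M UNIV \<beta>" "closed K" "K \<subseteq> U" "\<And>x. x \<notin> K \<Longrightarrow> \<beta> x = 0"
  shows "smooth_section M E UNIV (\<lambda>x. scl E (\<beta> x) (s x))"
proof (rule smooth_sectionI)
  show "scl E (\<beta> x) (s x) \<in> fibre E x" for x
    using smooth_section_fibre[OF assms(2), of x] assms(5) assms(6)[of x] fib.subspace_scale[OF fib.subspace_V]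
      fib.subspace_0[OF fib.subspace_V] by (cases "x \<in> K") auto
  fix W es assume W: "(W, es) \<in> frames E"
  from smooth_section_coeffs[OF assms(2) this] obtain k where
    k: "\<And>i. i < length es \<Longrightarrow> smooth_fun M (U \<inter> W) (k i)"
    "\<And>x. x \<in> U \<inter> W \<Longrightarrow> s x = lin_comb E es k x" by blast
  have "smooth_fun M W (\<lambda>x. \<beta> x * k i x)" if "i < length es" for i
    by (rule smooth_fun_cutoff[OF assms(1) frame_open[OF W] assms(3-6) k(1)[OF that]]) simp
  moreover have "scl E (\<beta> x) (s x) = lin_comb E es (\<lambda>i y. \<beta> y * k i y) x" if "x \<in> W" for x
  proof (cases "x \<in> U")
    case True
    then show ?thesis unfolding k(2)[OF IntI[OF True that]] scl_lin_comb by (simp add: lin_comb_def)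
  next
    case False
    then have "\<beta> x = 0" using assms(5,6) by blast
    then show ?thesis by (simp add: lin_comb_def)
  qed
  ultimately show "\<exists>k. (\<forall>i<length es. smooth_fun M (UNIV \<inter> W) (k i)) \<and>
        (\<forall>x\<in>UNIV \<inter> W. scl E (\<beta> x) (s x) = lin_comb E es k x)"
    by (intro exI[of _ "\<lambda>i x. \<beta> x * k i x"]) simp
qed

subsection \<open>Subbundles and orthogonal complements\<close>

lemma frame_lin_comb_zero:
  assumes "(W, es) \<in> frames E" "x \<in> W" "lin_comb E es f x = 0" "i < length es"
  shows "f i x = 0"
proof (rule fib.independent_nth_sum_zero[of "vals es x" "\<lambda>i. f i x"])
  show "distinct (vals es x)" "fib.independent (set (vals es x))"
    using frame_frame_on[OF assms(1)] assms(2) by (auto simp: frame_on_def)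
  show "(\<Sum>i<length (vals es x). scl E (f i x) (vals es x ! i)) = 0"
    using assms(3) by (simp add: lin_comb_def)
  show "i < length (vals es x)" using assms(4) by simp
qed

lemma frame_onD:
  assumes "frame_on E F U es" "x \<in> U"
  shows "distinct (vals es x)" "fib.independent (set (vals es x))" "fib.span (set (vals es x)) = F x"
  using assms by (auto simp: frame_on_def)

lemma subbundle_orthogonal_frame:
  assumes "holomorphic_subbundle M E F"
  obtains U ss gs where "open U" "x \<in> U" "\<And>s. s \<in> set ss \<Longrightarrow> hol_section M E U s"
    "frame_on E F U ss" "\<And>g. g \<in> set gs \<Longrightarrow> smooth_section M E U g"
    "\<And>y. y \<in> U \<Longrightarrow> orthogonal_list (fibre E y) (h y) (vals gs y)"
    "\<And>y. y \<in> U \<Longrightarrow> fib.span (set (vals gs y)) = F y"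
proof -
  obtain U0 ss where U0: "open U0" "x \<in> U0" "\<forall>s\<in>set ss. hol_section M E U0 s" "frame_on E F U0 ss"
    using assms unfolding holomorphic_subbundle_def by meson
  obtain U gs where U: "open U" "x \<in> U" "U \<subseteq> U0" "\<forall>g\<in>set gs. smooth_section M E U g"
    "\<forall>y\<in>U. orthogonal_list (fibre E y) (h y) (vals gs y) \<and>
       fib.span (set (vals gs y)) = fib.span (set (vals ss y))"
    using local_Gram_Schmidt[OF U0(1,2) _ frame_onD(1,2)[OF U0(4,2)]] U0(3) hol_section_smooth by meson
  show thesis
  proof (rule that[OF U(1,2)])
    show "hol_section M E U s" if "s \<in> set ss" for s using hol_section_subset U0(3) U(3) that by blast
    show "frame_on E F U ss" using U0(4) U(3) unfolding frame_on_def by blast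
    show "fib.span (set (vals gs y)) = F y" if "y \<in> U" for y
      using U(3,5) that frame_onD(3)[OF U0(4), of y] by auto
  qed (use U in auto)
qed

lemma whole_bundle_subbundle: "holomorphic_subbundle M E (fibre E)"
  unfolding holomorphic_subbundle_def
proof (intro conjI allI)
  fix x
  show "fib.subspace (fibre E x)" by (rule fib.subspace_V)
  obtain W es where W: "(W, es) \<in> frames E" "x \<in> W" using frame_nhd by blast
  then show "\<exists>U es. open U \<and> x \<in> U \<and> (\<forall>e\<in>set es. hol_section M E U e) \<and> frame_on E (fibre E) U es"
    by (intro exI[of _ W] exI[of _ es] conjI ballI frame_open[OF W(1)] frame_frame_on[OF W(1)]
        frame_hol[OF W(1)])
qed simp

lemma subbundle_subspace: "holomorphic_subbundle M E F \<Longrightarrow> fib.subspace (F x)"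
  and subbundle_fibre: "holomorphic_subbundle M E F \<Longrightarrow> F x \<subseteq> fibre E x"
  by (simp_all add: holomorphic_subbundle_def)

lemma orthogonal_complement_iff:
  "v \<in> orthogonal_complement E h F x \<longleftrightarrow> v \<in> fibre E x \<and> (\<forall>s\<in>F x. h x v s = 0)"
  by (simp add: orthogonal_complement_def)

lemma orthogonal_complement_subspace:
  assumes "F x \<subseteq> fibre E x"
  shows "fib.subspace (orthogonal_complement E h F x)"
proof (rule fib.subspaceI)
  have F: "s \<in> fibre E x" if "s \<in> F x" for s using that assms by (rule rev_subsetD)
  show "0 \<in> orthogonal_complement E h F x"
    using F by (simp add: orthogonal_complement_iff fib.H_zero fib.subspace_0[OF fib.subspace_V])
  show "v + w \<in> orthogonal_complement E h F x"
    if "v \<in> orthogonal_complement E h F x" "w \<in> orthogonal_complement E h F x" for v w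
    using that F by (simp add: orthogonal_complement_iff fib.H_add fib.subspace_add[OF fib.subspace_V])
  show "scl E a v \<in> orthogonal_complement E h F x"
    if "v \<in> orthogonal_complement E h F x" for a v
    using that F by (simp add: orthogonal_complement_iff fib.H_scale fib.subspace_scale[OF fib.subspace_V])
qed

lemma inter_orthogonal_complement:
  assumes "holomorphic_subbundle M E F"
  shows "F x \<inter> orthogonal_complement E h F x = {0}"
proof -
  have "v = 0" if "v \<in> F x" "v \<in> orthogonal_complement E h F x" for v
    using that fib.H_self_zero[of v x] by (simp add: orthogonal_complement_iff)
  moreover have "0 \<in> F x" "0 \<in> orthogonal_complement E h F x"
    by (rule fib.subspace_0[OF subbundle_subspace[OF assms]])
      (rule fib.subspace_0[OF orthogonal_complement_subspace[OF subbundle_fibre[OF assms]]])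
  ultimately show ?thesis by blast
qed

lemma orthogonal_splitting:
  assumes "holomorphic_subbundle M E F" "v \<in> fibre E x"
  obtains a b where "a \<in> F x" "b \<in> orthogonal_complement E h F x" "v = a + b"
proof -
  obtain U ss gs where g: "x \<in> U"
    "\<And>y. y \<in> U \<Longrightarrow> orthogonal_list (fibre E y) (h y) (vals gs y)"
    "\<And>y. y \<in> U \<Longrightarrow> fib.span (set (vals gs y)) = F y"
    by (rule subbundle_orthogonal_frame[OF assms(1), of x]) (rule that, assumption+)
  let ?p = "proj_on (scl E) (h x) (vals gs x) v"
  have "?p \<in> F x" using fib.proj_on_in_span g(1,3) by blast
  moreover have "v - ?p \<in> fibre E x"
    using assms(2) fib.proj_on_in_V[OF g(2)[OF g(1)]] fib.subspace_diff[OF fib.subspace_V] by blast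
  then have "v - ?p \<in> orthogonal_complement E h F x"
    using fib.proj_on_residual_orth[OF g(2)[OF g(1)] assms(2)] g(3)[OF g(1)]
    by (simp add: orthogonal_complement_iff)
  ultimately show thesis using that[of ?p "v - ?p"] by simp
qed

end

section \<open>Subbundles with vanishing second fundamental form\<close>

text \<open>A holomorphic subbundle \<open>S\<close> whose second fundamental form with respect to the Chern connection
  \<open>D\<close> vanishes on smooth sections of \<open>S\<close>.\<close>

locale parallel_subbundle = hermitian_bundle M E h
  for M :: "('m::{t2_space,second_countable_topology}, 'n::finite) chart set"
    and E :: "('m, 'v::ab_group_add) vbundle" and h :: "'m \<Rightarrow> 'v \<Rightarrow> 'v \<Rightarrow> complex" +
  fixes D :: "('m \<Rightarrow> 'v) \<Rightarrow> 'm \<Rightarrow> ('m, 'n) tvec \<Rightarrow> 'v" and S :: "'m \<Rightarrow> 'v set"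
  assumes chern: "chern_connection M E h D"
    and subbundle: "holomorphic_subbundle M E S"
    and second_fundamental_form_zero: "smooth_section_in M E S \<xi> \<Longrightarrow> X \<in> tangent_space M x \<Longrightarrow>
      second_fundamental_form E h D S \<xi> x X = 0"
begin

abbreviation S_perp :: "'m \<Rightarrow> 'v set" where
  "S_perp \<equiv> orthogonal_complement E h S"

lemma S_fibre: "v \<in> S x \<Longrightarrow> v \<in> fibre E x"
  using subbundle_fibre[OF subbundle] by blast

lemma S_perp_fibre: "v \<in> S_perp x \<Longrightarrow> v \<in> fibre E x"
  by (simp add: orthogonal_complement_iff)

lemma S_perp_subspace: "fib.subspace (S_perp x)"
  by (rule orthogonal_complement_subspace[OF subbundle_fibre[OF subbundle]])

lemma D_fibre:
  assumes "smooth_section M E UNIV \<xi>" "X \<in> tangent_space M x"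
  shows "D \<xi> x X \<in> fibre E x"
proof -
  have "one_form M E (D \<xi>)"
    using chern assms(1) by (simp add: chern_connection_def metric_connection_def connection_def)
  then show ?thesis using assms(2) unfolding one_form_def by blast
qed

lemma D_metric:
  assumes "smooth_section M E UNIV s" "smooth_section M E UNIV t" "X \<in> tangent_space M x"
  shows "differential M (\<lambda>y. h y (s y) (t y)) x X = h x (D s x X) (t x) + h x (s x) (D t x X)"
  using chern assms by (simp add: chern_connection_def metric_connection_def)

lemma D_part01:
  assumes "smooth_section M E UNIV s" "(U, es) \<in> frames E"
    and "\<And>i. i < length es \<Longrightarrow> smooth_fun M U (f i)" "\<And>x. x \<in> U \<Longrightarrow> s x = lin_comb E es f x"
    and "x \<in> U" "X \<in> tangent_space M x"
  shows "part01 (scl E) (D s) x X = lin_comb E es (\<lambda>i y. dbar (f i) y X) x"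
proof -
  have "\<forall>(U, es)\<in>frames E. \<forall>f.
        (\<forall>i<length es. smooth_fun M U (f i)) \<longrightarrow> (\<forall>x\<in>U. s x = lin_comb E es f x) \<longrightarrow>
        (\<forall>x\<in>U. \<forall>X\<in>tangent_space M x. part01 (scl E) (D s) x X =
           lin_comb E es (\<lambda>i y. dbar (f i) y X) x)"
    using chern assms(1) unfolding chern_connection_def by blast
  from bspec[OF this assms(2)] show ?thesis using assms(3-6) by simp
qed

lemma D_preserves_S:
  assumes "smooth_section_in M E S \<xi>" "X \<in> tangent_space M x"
  shows "D \<xi> x X \<in> S x"
proof -
  have "D \<xi> x X \<in> fibre E x"
    by (rule D_fibre) (use assms in \<open>simp_all add: smooth_section_in_def\<close>)
  then obtain a b where ab: "a \<in> S x" "b \<in> S_perp x" "D \<xi> x X = a + b"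
    by (rule orthogonal_splitting[OF subbundle])
  \<comment> \<open>By uniqueness of the decomposition, the second fundamental form is the component \<open>b\<close>.\<close>
  have "(THE \<eta>. \<eta> \<in> S_perp x \<and> (\<exists>\<sigma>\<in>S x. D \<xi> x X = \<sigma> + \<eta>)) = b"
  proof (rule the_equality)
    show "b \<in> S_perp x \<and> (\<exists>\<sigma>\<in>S x. D \<xi> x X = \<sigma> + b)" using ab by blast
    fix b' assume "b' \<in> S_perp x \<and> (\<exists>\<sigma>\<in>S x. D \<xi> x X = \<sigma> + b')"
    then obtain a' where b': "b' \<in> S_perp x" "a' \<in> S x" "D \<xi> x X = a' + b'" by blast
    have eq: "b' - b = a - a'" using ab(3) b'(3) by (simp add: algebra_simps)
    have "b' - b \<in> S_perp x" by (rule fib.subspace_diff[OF S_perp_subspace b'(1) ab(2)])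
    moreover have "b' - b \<in> S x"
      unfolding eq by (rule fib.subspace_diff[OF subbundle_subspace[OF subbundle] ab(1) b'(2)])
    ultimately have "b' - b = 0" using inter_orthogonal_complement[OF subbundle, of x] by blast
    then show "b' = b" by simp
  qed
  then have "b = 0"
    using second_fundamental_form_zero[OF assms] by (simp add: second_fundamental_form_def)
  then show ?thesis using ab by simp
qed

text \<open>For \<open>\<xi>\<close> in the orthogonal complement and \<open>\<sigma>\<close> in \<open>S\<close>, differentiating \<open>h(\<xi>,\<sigma>) = 0\<close> gives
  \<open>h(D\<xi>,\<sigma>) = - h(\<xi>,D\<sigma>) = 0\<close>, since \<open>D\<sigma>\<close> has values in \<open>S\<close>.\<close>

lemma D_preserves_S_perp:
  assumes "smooth_section_in M E S_perp \<xi>" "X \<in> tangent_space M x"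
  shows "D \<xi> x X \<in> S_perp x"
proof -
  have \<xi>: "smooth_section M E UNIV \<xi>" "\<xi> y \<in> S_perp y" for y
    using assms(1) by (simp_all add: smooth_section_in_def)
  have DE: "D \<xi> x X \<in> fibre E x" by (rule D_fibre[OF \<xi>(1) assms(2)])
  obtain U ss where U: "open U" "x \<in> U" "\<forall>s\<in>set ss. hol_section M E U s" "frame_on E S U ss"
    using subbundle unfolding holomorphic_subbundle_def by meson
  obtain \<beta> :: "'m \<Rightarrow> complex" and K where \<beta>: "smooth_fun M UNIV \<beta>" "\<beta> x \<noteq> 0"
    "closed K" "K \<subseteq> U" "\<And>x. x \<notin> K \<Longrightarrow> \<beta> x = 0"
    using bump_function[OF U(1,2)] by blast
  have orth: "h x (D \<xi> x X) (s x) = 0" if s: "s \<in> set ss" for s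
  proof -
    let ?\<sigma> = "\<lambda>y. scl E (\<beta> y) (s y)"
    have sm: "smooth_section M E UNIV ?\<sigma>"
      by (rule smooth_section_cutoff[OF U(1) hol_section_smooth \<beta>(1,3-5)]) (use U(3) s in simp)
    have sS: "s y \<in> S y" if "y \<in> U" for y
      using frame_onD(3)[OF U(4) that] fib.span_base[of "s y" "set (vals ss y)"] s by auto
    have \<sigma>S: "?\<sigma> y \<in> S y" for y
      using fib.subspace_scale[OF subbundle_subspace[OF subbundle] sS, of y]
        fib.subspace_0[OF subbundle_subspace[OF subbundle]] \<beta>(4) \<beta>(5)[of y]
      by (cases "y \<in> K") auto
    have "smooth_section_in M E S ?\<sigma>" using sm \<sigma>S by (simp add: smooth_section_in_def)
    from D_preserves_S[OF this assms(2)] have "h x (\<xi> x) (D ?\<sigma> x X) = 0"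
      using \<xi>(2)[of x] by (simp add: orthogonal_complement_iff)
    moreover have "h y (\<xi> y) (?\<sigma> y) = 0" for y
      using \<xi>(2)[of y] \<sigma>S[of y] by (simp add: orthogonal_complement_iff)
    ultimately have "h x (D \<xi> x X) (?\<sigma> x) = 0"
      using D_metric[OF \<xi>(1) sm assms(2)] differential_zero by simp
    then show ?thesis
      using \<beta>(2) fib.H_scale_right[OF S_fibre[OF sS[OF U(2)]] DE] by simp
  qed
  have "h x (D \<xi> x X) v = 0" if v: "v \<in> S x" for v
  proof (rule fib.orth_span_right[OF DE])
    show "set (vals ss x) \<subseteq> fibre E x"
      using frame_onD(3)[OF U(4,2)] fib.span_superset[of "set (vals ss x)"] S_fibre by blast
    show "h x (D \<xi> x X) b = 0" if "b \<in> set (vals ss x)" for b using orth that by auto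
    show "v \<in> fib.span (set (vals ss x))" using v frame_onD(3)[OF U(4,2)] by simp
  qed
  then show ?thesis using DE by (simp add: orthogonal_complement_iff)
qed

text \<open>A family of subspaces that is preserved by \<open>D\<close> is preserved by the Dolbeault operator, also
  for local sections. As \<open>D\<close> acts on global sections only, a local section \<open>s\<close> is multiplied by a
  bump function \<open>\<beta>\<close>; the additional term of the Leibniz rule is a multiple of \<open>s\<close> and does no harm.\<close>

lemma dbar_preserves:
  assumes F: "\<And>\<xi> x X. smooth_section_in M E F \<xi> \<Longrightarrow> X \<in> tangent_space M x \<Longrightarrow> D \<xi> x X \<in> F x"
    and sub: "\<And>x. fib.subspace (F x)"
    and U: "open U" "smooth_section M E U s" "\<And>y. y \<in> U \<Longrightarrow> s y \<in> F y"
    and W: "(W, es) \<in> frames E"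
    and f: "\<And>i. i < length es \<Longrightarrow> smooth_fun M (U \<inter> W) (f i)"
      "\<And>y. y \<in> U \<inter> W \<Longrightarrow> s y = lin_comb E es f y"
    and x: "x \<in> U \<inter> W" "X \<in> tangent_space M x"
  shows "lin_comb E es (\<lambda>i y. dbar (f i) y X) x \<in> F x"
proof -
  let ?L = "lin_comb E es (\<lambda>i y. dbar (f i) y X) x"
  obtain \<beta> :: "'m \<Rightarrow> complex" and K where \<beta>: "smooth_fun M UNIV \<beta>" "\<beta> x \<noteq> 0"
    "closed K" "K \<subseteq> U" "\<And>x. x \<notin> K \<Longrightarrow> \<beta> x = 0"
    using bump_function[OF U(1), of x] x(1) by blast
  let ?\<xi> = "\<lambda>y. scl E (\<beta> y) (s y)"
  have sm: "smooth_section M E UNIV ?\<xi>"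
    by (rule smooth_section_cutoff[OF U(1,2) \<beta>(1,3-5)])
  have "?\<xi> y \<in> F y" for y
    using fib.subspace_scale[OF sub U(3), of y] fib.subspace_0[OF sub] \<beta>(4) \<beta>(5)[of y]
    by (cases "y \<in> K") auto
  then have "smooth_section_in M E F ?\<xi>" using sm by (simp add: smooth_section_in_def)
  then have "part01 (scl E) (D ?\<xi>) x X \<in> F x"
    unfolding part01_def
    by (intro fib.subspace_scale[OF sub] fib.subspace_add[OF sub] F x tangent_J_in)
  also have "part01 (scl E) (D ?\<xi>) x X = lin_comb E es (\<lambda>i y. dbar (\<lambda>y. \<beta> y * f i y) y X) x"
  proof (rule D_part01[OF sm W])
    show "smooth_fun M W (\<lambda>y. \<beta> y * f i y)" if "i < length es" for i
      by (rule smooth_fun_cutoff[OF U(1) frame_open[OF W] \<beta>(1,3-5) f(1)[OF that]])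
    show "?\<xi> y = lin_comb E es (\<lambda>i y. \<beta> y * f i y) y" if "y \<in> W" for y
    proof (cases "y \<in> U")
      case True
      then show ?thesis unfolding f(2)[OF IntI[OF True that]] scl_lin_comb by (simp add: lin_comb_def)
    next
      case False
      then have "\<beta> y = 0" using \<beta>(4,5) by blast
      then show ?thesis by (simp add: lin_comb_def)
    qed
  qed (use x in auto)
  also have "\<dots> = lin_comb E es (\<lambda>i y. \<beta> y * dbar (f i) y X + dbar \<beta> x X * f i y) x"
  proof -
    have o: "open (U \<inter> W)" using U(1) frame_open[OF W] by blast
    have "dbar (\<lambda>y. \<beta> y * f i y) x X = \<beta> x * dbar (f i) x X + dbar \<beta> x X * f i x"
      if "i < length es" for i
      by (rule dbar_mult[OF o x(1) smooth_fun_subset[OF \<beta>(1)] f(1)[OF that]]) simp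
    then show ?thesis by (simp add: lin_comb_def)
  qed
  also have "\<dots> = scl E (\<beta> x) ?L + scl E (dbar \<beta> x X) (s x)"
    unfolding f(2)[OF x(1)] scl_lin_comb lin_comb_add by (simp add: lin_comb_def)
  finally have "scl E (\<beta> x) ?L + scl E (dbar \<beta> x X) (s x) \<in> F x" .
  moreover have "scl E (dbar \<beta> x X) (s x) \<in> F x"
    by (rule fib.subspace_scale[OF sub U(3)]) (use x in simp)
  ultimately have "scl E (\<beta> x) ?L \<in> F x"
    using fib.subspace_diff[OF sub] by fastforce
  then have "scl E (inverse (\<beta> x)) (scl E (\<beta> x) ?L) \<in> F x" by (rule fib.subspace_scale[OF sub])
  then show ?thesis using \<beta>(2) by simp
qed

text \<open>The component of a holomorphic section in the orthogonal complement of \<open>S\<close> is holomorphic: the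
  Dolbeault operator maps it into the orthogonal complement, and also into \<open>S\<close>, because its image is
  the negative of that of the component in \<open>S\<close>.\<close>

lemma hol_section_orthogonal_part:
  assumes U: "open U" "\<And>g. g \<in> set gs \<Longrightarrow> smooth_section M E U g"
    "\<And>y. y \<in> U \<Longrightarrow> orthogonal_list (fibre E y) (h y) (vals gs y)"
    "\<And>y. y \<in> U \<Longrightarrow> fib.span (set (vals gs y)) = S y"
    and e: "hol_section M E U e"
  shows "hol_section M E U (\<lambda>x. e x - proj_sec gs e x)"
    and "\<And>x. x \<in> U \<Longrightarrow> e x - proj_sec gs e x \<in> S_perp x"
proof -
  let ?p = "proj_sec gs e" and ?q = "\<lambda>x. e x - proj_sec gs e x"
  have es: "smooth_section M E U e" by (rule hol_section_smooth[OF e])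
  have ps: "smooth_section M E U ?p" by (rule smooth_section_proj[OF U(1) es U(2,3)])
  have qs: "smooth_section M E U ?q" by (rule smooth_section_diff[OF U(1) es ps])
  have pS: "?p x \<in> S x" if "x \<in> U" for x
    using fib.proj_on_in_span[where x = x and gs = "vals gs x" and v = "e x"] U(4)[OF that] by simp
  show qS: "?q x \<in> S_perp x" if x: "x \<in> U" for x
    using fib.proj_on_residual_orth[OF U(3)[OF x] smooth_section_fibre[OF es x]] U(4)[OF x]
      smooth_section_fibre[OF qs x] by (simp add: orthogonal_complement_iff)
  show "hol_section M E U ?q"
  proof (rule hol_sectionI)
    show "?q x \<in> fibre E x" if "x \<in> U" for x using qS[OF that] by (rule S_perp_fibre)
    fix W es assume W: "(W, es) \<in> frames E"
    obtain a where a: "\<And>i. i < length es \<Longrightarrow> hol_fun M (U \<inter> W) (a i)"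
      "\<And>x. x \<in> U \<inter> W \<Longrightarrow> e x = lin_comb E es a x"
      by (rule hol_section_coeffs[OF e W]) (rule that, assumption+)
    obtain b where b: "\<And>i. i < length es \<Longrightarrow> smooth_fun M (U \<inter> W) (b i)"
      "\<And>x. x \<in> U \<inter> W \<Longrightarrow> ?p x = lin_comb E es b x"
      by (rule smooth_section_coeffs[OF ps W]) (rule that, assumption+)
    let ?c = "\<lambda>i x. a i x - b i x"
    have o: "open (U \<inter> W)" using U(1) frame_open[OF W] by blast
    have c: "smooth_fun M (U \<inter> W) (?c i)" if "i < length es" for i
      by (rule smooth_fun_diff[OF o hol_fun_smooth[OF a(1)[OF that]] b(1)[OF that]])
    have qc: "?q x = lin_comb E es ?c x" if "x \<in> U \<inter> W" for x
      using a(2)[OF that] b(2)[OF that] by (simp add: lin_comb_diff)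
    have zero: "dbar (?c i) x X = 0"
      if i: "i < length es" and x: "x \<in> U \<inter> W" "X \<in> tangent_space M x" for i x X
    proof -
      let ?B = "lin_comb E es (\<lambda>i y. dbar (b i) y X) x"
        and ?C = "lin_comb E es (\<lambda>i y. dbar (?c i) y X) x"
      have B: "?B \<in> S x"
        by (rule dbar_preserves[OF D_preserves_S subbundle_subspace[OF subbundle] U(1) ps pS W b x])
      have C: "?C \<in> S_perp x"
        by (rule dbar_preserves[OF D_preserves_S_perp S_perp_subspace U(1) qs qS W c qc x])
      \<comment> \<open>The coefficients \<open>a i\<close> of \<open>e\<close> are holomorphic and contribute nothing.\<close>
      have "dbar (?c i) x X = - 1 * dbar (b i) x X" if "i < length es" for i
        using dbar_diff[OF o x(1) hol_fun_smooth[OF a(1)[OF that]] b(1)[OF that]]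
          dbar_hol[OF a(1)[OF that] x(1)] by simp
      then have "?C = lin_comb E es (\<lambda>i y. - 1 * dbar (b i) y X) x"
        by (simp add: lin_comb_def)
      also have "\<dots> = scl E (- 1) ?B" unfolding scl_lin_comb ..
      finally have "?C \<in> S x" using fib.subspace_scale[OF subbundle_subspace[OF subbundle] B, of "- 1"]
        by (simp only:)
      then have "?C = 0" using C inter_orthogonal_complement[OF subbundle, of x] by blast
      then show ?thesis using frame_lin_comb_zero[OF W, of x "\<lambda>i y. dbar (?c i) y X" i] x i by simp
    qed
    have "hol_fun M (U \<inter> W) (?c i)" if "i < length es" for i
      by (rule hol_fun_if_dbar_zero[OF o c[OF that] zero[OF that]])
    then show "\<exists>f. (\<forall>i<length es. hol_fun M (U \<inter> W) (f i)) \<and>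
        (\<forall>x\<in>U \<inter> W. ?q x = lin_comb E es f x)"
      using qc by (intro exI[of _ ?c]) simp
  qed
qed

end

text \<open>The orthogonal components of a holomorphic frame \<open>es\<close> of \<open>E\<close> span the orthogonal complement.
  Some of them complete a frame \<open>ss\<close> of \<open>S\<close> to a basis of the fibre over \<open>x0\<close>; the resulting sections
  stay linearly independent near \<open>x0\<close>, and thus span the fibres by counting.\<close>

lemma (in parallel_subbundle) S_perp_subbundle: "holomorphic_subbundle M E S_perp"
  unfolding holomorphic_subbundle_def
proof (intro conjI allI)
  show "fib.subspace (S_perp x)" for x by (rule S_perp_subspace)
  show "S_perp x \<subseteq> fibre E x" for x using S_perp_fibre by blast
  fix x0
  obtain U ss gs where U: "open U" "x0 \<in> U" and ss: "\<And>s. s \<in> set ss \<Longrightarrow> hol_section M E U s"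
    "frame_on E S U ss" and gs: "\<And>g. g \<in> set gs \<Longrightarrow> smooth_section M E U g"
    "\<And>y. y \<in> U \<Longrightarrow> orthogonal_list (fibre E y) (h y) (vals gs y)"
    "\<And>y. y \<in> U \<Longrightarrow> fib.span (set (vals gs y)) = S y"
    by (rule subbundle_orthogonal_frame[OF subbundle, of x0]) (rule that, assumption+)
  obtain W es where W: "(W, es) \<in> frames E" "x0 \<in> W" using frame_nhd by blast
  define q where "q e x = e x - proj_sec gs e x" for e x
  let ?V = "U \<inter> W"
  have V: "open ?V" "x0 \<in> ?V" using U W frame_open[OF W(1)] by auto
  have q: "hol_section M E ?V (q e)" "x \<in> ?V \<Longrightarrow> q e x \<in> S_perp x" if "e \<in> set es" for e x
  proof -
    have "hol_section M E ?V e" by (rule hol_section_subset[OF frame_hol[OF W(1) that]]) simp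
    from hol_section_orthogonal_part[OF V(1) smooth_section_subset[OF gs(1)] gs(2,3) this]
    show "hol_section M E ?V (q e)" "x \<in> ?V \<Longrightarrow> q e x \<in> S_perp x"
      unfolding q_def by simp_all
  qed
  have es: "distinct (vals es x)" "fib.independent (set (vals es x))"
      "fib.span (set (vals es x)) = fibre E x" if "x \<in> W" for x
    using frame_onD[OF frame_frame_on[OF W(1)] that] by simp_all
  let ?A = "set (vals ss x0)" and ?Q = "(\<lambda>e. q e x0) ` set es"
  have A: "distinct (vals ss x0)" "fib.independent ?A" "fib.span ?A = S x0"
    using frame_onD[OF ss(2) U(2)] by simp_all
  obtain B where B: "?A \<subseteq> B" "B \<subseteq> ?A \<union> ?Q" "fib.independent B" "?A \<union> ?Q \<subseteq> fib.span B"
    using fib.maximal_independent_subset_extend[OF _ A(2), of "?A \<union> ?Q"] by auto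
  have finB: "finite B" by (rule finite_subset[OF B(2)]) simp
  have AQ: "?A \<union> ?Q \<subseteq> fibre E x0"
    using A(3) fib.span_superset[of ?A] S_fibre q(2)[OF _ V(2)] S_perp_fibre by blast
  have "set (vals es x0) \<subseteq> fib.span B"
  proof
    fix v assume "v \<in> set (vals es x0)"
    then obtain e where e: "e \<in> set es" "v = e x0" by auto
    have "proj_sec gs e x0 \<in> fib.span ?A"
      using fib.proj_on_in_span[where x = x0 and gs = "vals gs x0" and v = "e x0"] gs(3)[OF U(2)] A(3)
      by simp
    then have "proj_sec gs e x0 \<in> fib.span B" using fib.span_mono[OF B(1)] by blast
    moreover have "q e x0 \<in> fib.span B" using B(4) e(1) by blast
    ultimately have "proj_sec gs e x0 + q e x0 \<in> fib.span B" by (rule fib.span_add)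
    then show "v \<in> fib.span B" by (simp add: q_def e(2))
  qed
  moreover have "B \<subseteq> fib.span (set (vals es x0))" using B(2) AQ es(3)[OF W(2)] by blast
  \<comment> \<open>\<open>B\<close> and the values of \<open>es\<close> are both bases of the fibre over \<open>x0\<close>.\<close>
  ultimately have "card B = card (set (vals es x0))"
    using fib.independent_span_bound[OF finB es(2)[OF W(2)]]
      fib.independent_span_bound[OF finite_set B(3)] by (meson le_antisym)
  then have cardB: "card B = length es" using distinct_card[OF es(1)[OF W(2)]] by simp

  obtain bs where bs: "distinct bs" "set bs = B - ?A"
    using finite_distinct_list[of "B - ?A"] finB by blast
  have "\<exists>e. e \<in> set es \<and> q e x0 = b" if "b \<in> set bs" for b
    using that bs(2) B(2) by blast
  then obtain ch where ch: "\<And>b. b \<in> set bs \<Longrightarrow> ch b \<in> set es \<and> q (ch b) x0 = b" by metis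
  define ts where "ts = map (\<lambda>b. q (ch b)) bs"
  have ts: "\<exists>e\<in>set es. t = q e" if "t \<in> set ts" for t
    using that ch unfolding ts_def by auto
  have tsx0: "vals ts x0 = bs" using ch unfolding ts_def by (simp add: map_idI)
  have dist: "distinct (vals (ss @ ts) x0)" using A(1) bs tsx0 by auto
  have setB: "set (vals (ss @ ts) x0) = B"
    using bs(2) B(1) tsx0 unfolding map_append set_append by auto
  have len: "length (ss @ ts) = length es"
    using distinct_card[OF dist] setB cardB by simp
  have sm: "smooth_section M E ?V s" if "s \<in> set (ss @ ts)" for s
  proof -
    have "hol_section M E ?V s"
    proof (cases "s \<in> set ss")
      case True
      show ?thesis by (rule hol_section_subset[OF ss(1)[OF True]]) simp
    next
      case False
      then obtain e where "e \<in> set es" "s = q e" using ts \<open>s \<in> set (ss @ ts)\<close> by auto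
      then show ?thesis using q(1) by simp
    qed
    then show ?thesis by (rule hol_section_smooth)
  qed
  have "fib.independent (set (vals (ss @ ts) x0))" unfolding setB by (rule B(3))
  from local_Gram_Schmidt[OF V sm dist this] obtain V' where V': "open V'" "x0 \<in> V'" "V' \<subseteq> ?V"
    "\<And>x. x \<in> V' \<Longrightarrow> distinct (vals (ss @ ts) x) \<and> fib.independent (set (vals (ss @ ts) x))"
    by blast
  have "fib.span (set (vals ts x)) = S_perp x" if x: "x \<in> V'" for x
  proof
    have xV: "x \<in> U" "x \<in> W" "x \<in> ?V" using x V'(3) by auto
    have T: "set (vals ts x) \<subseteq> S_perp x"
    proof
      fix v assume "v \<in> set (vals ts x)"
      then obtain t where t: "t \<in> set ts" "v = t x" by auto
      then show "v \<in> S_perp x" using ts[OF t(1)] q(2)[OF _ xV(3)] by auto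
    qed
    show sub: "fib.span (set (vals ts x)) \<subseteq> S_perp x"
      by (rule fib.span_minimal[OF T S_perp_subspace])
    have Sx: "fib.span (set (vals ss x)) = S x" by (rule frame_onD(3)[OF ss(2) xV(1)])
    have "set (vals (ss @ ts) x) \<subseteq> fib.span (set (vals es x))"
      using T S_perp_fibre S_fibre Sx fib.span_superset[of "set (vals ss x)"]
      unfolding es(3)[OF xV(2)] map_append set_append by blast
    moreover have "card (set (vals (ss @ ts) x)) = card (set (vals es x))"
      using distinct_card[of "vals (ss @ ts) x"] distinct_card[OF es(1)[OF xV(2)]] V'(4)[OF x] len
      by simp
    ultimately have "fib.span (set (vals (ss @ ts) x)) = fibre E x"
      using fib.span_eq_if_card_eq[OF finite_set] V'(4)[OF x] es(3)[OF xV(2)] by metis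
    then have span: "fib.span (set (vals ss x) \<union> set (vals ts x)) = fibre E x"
      unfolding map_append set_append .
    show "S_perp x \<subseteq> fib.span (set (vals ts x))"
    proof
      fix v assume v: "v \<in> S_perp x"
      then have "v \<in> fib.span (set (vals ss x) \<union> set (vals ts x))"
        unfolding span by (rule S_perp_fibre)
      then obtain a b where ab: "a \<in> S x" "b \<in> fib.span (set (vals ts x))" "v = a + b"
        unfolding fib.span_Un Sx by blast
      have "v - b \<in> S_perp x" by (rule fib.subspace_diff[OF S_perp_subspace v]) (use ab sub in blast)
      then have "a \<in> S_perp x" using ab(3) by simp
      then have "a = 0" using ab(1) inter_orthogonal_complement[OF subbundle, of x] by blast
      then show "v \<in> fib.span (set (vals ts x))" using ab by simp
    qed
  qed
  moreover have "distinct (vals ts x)" "fib.independent (set (vals ts x))" if x: "x \<in> V'" for x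
    using V'(4)[OF x] fib.independent_mono[of "set (vals (ss @ ts) x)" "set (vals ts x)"]
    by simp_all
  ultimately have "frame_on E S_perp V' ts" by (simp add: frame_on_def)
  moreover have "hol_section M E V' t" if "t \<in> set ts" for t
    using ts[OF that] q(1) hol_section_subset[OF _ V'(3)] by blast
  ultimately show "\<exists>U es. open U \<and> x0 \<in> U \<and> (\<forall>e\<in>set es. hol_section M E U e) \<and>
      frame_on E S_perp U es"
    using V'(1,2) by (intro exI[of _ V'] exI[of _ ts] conjI ballI)
qed

section \<open>The Higgs orthogonal decomposition\<close>

text \<open>A vector \<open>v\<close> orthogonal to \<open>F\<close> satisfies \<open>h(s,\<Phi>v) = h(\<Phi>\<^sup>*s,v) = 0\<close> for \<open>s\<close> in \<open>F\<close>, where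
  \<open>\<Phi>\<^sup>*\<close> is the hermitian conjugate. The defining property of \<open>\<Phi>\<^sup>*s\<close> is available because its
  definite description is satisfied, by the representation of functionals.\<close>

lemma (in hermitian_bundle) orthogonal_complement_invariant:
  assumes \<Phi>: "end_form10 M E \<Phi>" and F: "holomorphic_subbundle M E F"
    and inv: "invariant_under M (hermitian_conjugate E h \<Phi>) F"
  shows "invariant_under M \<Phi> (orthogonal_complement E h F)"
  unfolding invariant_under_def
proof (intro allI ballI)
  fix x X v assume X: "X \<in> tangent_space M x" and v: "v \<in> orthogonal_complement E h F x"
  have vE: "v \<in> fibre E x" using v by (simp add: orthogonal_complement_iff)
  have \<Phi>E: "\<Phi> x X u \<in> fibre E x" if "u \<in> fibre E x" for u
    using \<Phi> X that unfolding end_form10_def by blast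
  have lin: "\<Phi> x X (scl E a u + scl E b w) = scl E a (\<Phi> x X u) + scl E b (\<Phi> x X w)"
    if "u \<in> fibre E x" "w \<in> fibre E x" for a b u w
    using \<Phi> X that unfolding end_form10_def by blast
  have "h x (\<Phi> x X v) s = 0" if s: "s \<in> F x" for s
  proof -
    have sE: "s \<in> fibre E x" using s subbundle_fibre[OF F] by blast
    obtain U ss gs where U: "x \<in> U"
      "\<And>y. y \<in> U \<Longrightarrow> orthogonal_list (fibre E y) (h y) (vals gs y)"
      "\<And>y. y \<in> U \<Longrightarrow> fib.span (set (vals gs y)) = fibre E y"
      by (rule subbundle_orthogonal_frame[OF whole_bundle_subbundle, of x]) (rule that, assumption+)
    have add: "h x s (\<Phi> x X (u + w)) = h x s (\<Phi> x X u) + h x s (\<Phi> x X w)"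
      if "u \<in> fibre E x" "w \<in> fibre E x" for u w
      using lin[OF that, of 1 1] fib.H_add_right[OF \<Phi>E[OF that(1)] \<Phi>E[OF that(2)] sE] by simp
    have scale: "h x s (\<Phi> x X (scl E a u)) = cnj a * h x s (\<Phi> x X u)"
      if "u \<in> fibre E x" for a u
      using lin[OF that that, of a 0] fib.H_scale_right[OF \<Phi>E[OF that] sE] by simp
    obtain z where z: "z \<in> fibre E x" "\<And>u. u \<in> fibre E x \<Longrightarrow> h x z u = h x s (\<Phi> x X u)"
      by (rule fib.functional_representation[OF U(2)[OF U(1)] U(3)[OF U(1)],
            where f = "\<lambda>u. h x s (\<Phi> x X u)"]) (rule add scale that, assumption+)+
    have "hermitian_conjugate E h \<Phi> x X s = z"
      unfolding hermitian_conjugate_def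
    proof (rule the_equality)
      show "z \<in> fibre E x \<and> (\<forall>\<eta>\<in>fibre E x. h x z \<eta> = h x s (\<Phi> x X \<eta>))" using z by blast
      fix z' assume z': "z' \<in> fibre E x \<and> (\<forall>\<eta>\<in>fibre E x. h x z' \<eta> = h x s (\<Phi> x X \<eta>))"
      have d: "z' - z \<in> fibre E x" using fib.subspace_diff[OF fib.subspace_V] z' z(1) by blast
      have "h x (z' - z) (z' - z) = 0"
        using fib.H_diff[of z' x z "z' - z"] z' z d by simp
      then have "z' - z = 0" by (rule fib.H_self_zero[OF d])
      then show "z' = z" by simp
    qed
    moreover have "hermitian_conjugate E h \<Phi> x X s \<in> F x"
      using inv X s unfolding invariant_under_def by blast
    ultimately have "h x v z = 0" using v by (simp add: orthogonal_complement_iff)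
    then have "h x z v = 0" by (rule fib.H_orth_sym[OF vE z(1)])
    then have "h x s (\<Phi> x X v) = 0" using z(2)[OF vE] by simp
    then show ?thesis by (rule fib.H_orth_sym[OF sE \<Phi>E[OF vE]])
  qed
  then show "\<Phi> x X v \<in> orthogonal_complement E h F x"
    using \<Phi>E[OF vE] by (simp add: orthogonal_complement_iff)
qed

theorem proposition8:
  fixes M :: "('m::{t2_space,second_countable_topology}, 'n::finite) chart set"
    and g :: "'m \<Rightarrow> ('m, 'n) tvec \<Rightarrow> ('m, 'n) tvec \<Rightarrow> real"
    and E :: "('m, 'v::ab_group_add) vbundle"
    and \<Phi> :: "('m, 'n, 'v) end_form"
    and h :: "'m \<Rightarrow> 'v \<Rightarrow> 'v \<Rightarrow> complex"
    and D :: "('m \<Rightarrow> 'v) \<Rightarrow> 'm \<Rightarrow> ('m, 'n) tvec \<Rightarrow> 'v"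
    and S :: "'m \<Rightarrow> 'v set"
  assumes "compact_kaehler_manifold M g"
    and "hermitian_higgs_bundle M E \<Phi> h"
    and "chern_connection M E h D"
    and "holomorphic_subbundle M E S"
    and "\<forall>\<xi>. smooth_section_in M E S \<xi> \<longrightarrow>
           (\<forall>x. \<forall>X\<in>tangent_space M x. second_fundamental_form E h D S \<xi> x X = 0)"
    and "invariant_under M \<Phi> S"
    and "invariant_under M (hermitian_conjugate E h \<Phi>) S"
  shows "higgs_subbundle M E \<Phi> S \<and>
    higgs_subbundle M E \<Phi> (orthogonal_complement E h S) \<and>
    higgs_orthogonal_decomposition M E \<Phi> h S (orthogonal_complement E h S)"
proof -
  interpret parallel_subbundle M E h D S
  proof unfold_locales
    show "complex_manifold M" using assms(1) by (simp add: compact_kaehler_manifold_def)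
    show "holomorphic_vector_bundle M E" "hermitian_metric M E h"
      using assms(2) by (simp_all add: hermitian_higgs_bundle_def higgs_bundle_def)
  qed (use assms(3-5) in blast)+
  have \<Phi>: "end_form10 M E \<Phi>"
    using assms(2) by (simp add: hermitian_higgs_bundle_def higgs_bundle_def)
  have S: "higgs_subbundle M E \<Phi> S" using assms(4,6) by (simp add: higgs_subbundle_def)
  have S_perp: "higgs_subbundle M E \<Phi> S_perp"
    using S_perp_subbundle orthogonal_complement_invariant[OF \<Phi> assms(4,7)]
    by (simp add: higgs_subbundle_def)
  have "fibre E x = {v + w | v w. v \<in> S x \<and> w \<in> S_perp x}" for x
  proof
    show "fibre E x \<subseteq> {v + w | v w. v \<in> S x \<and> w \<in> S_perp x}"
    proof
      fix u assume "u \<in> fibre E x"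
      then show "u \<in> {v + w | v w. v \<in> S x \<and> w \<in> S_perp x}"
        by (rule orthogonal_splitting[OF subbundle]) blast
    qed
    show "{v + w | v w. v \<in> S x \<and> w \<in> S_perp x} \<subseteq> fibre E x"
      using fib.subspace_add[OF fib.subspace_V S_fibre S_perp_fibre] by blast
  qed
  then have "holomorphic_direct_sum M E S S_perp"
    using assms(4) S_perp_subbundle inter_orthogonal_complement[OF subbundle]
    unfolding holomorphic_direct_sum_def by blast
  moreover have "h x v w = 0" if "v \<in> S x" "w \<in> S_perp x" for x v w
    using that fib.H_orth_sym[OF S_perp_fibre S_fibre, of w x v]
    by (simp add: orthogonal_complement_iff)
  ultimately have "higgs_orthogonal_decomposition M E \<Phi> h S S_perp"
    using S S_perp by (simp add: higgs_orthogonal_decomposition_def)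
  with S S_perp show ?thesis by blast
qed

end
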